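(* Let $n$ be a positive odd integer, and for $k\geqslant 0$ let $$c_q(k)=(-1)^kq^{k^2}[4k+1]\frac{(aq,q/a,q;q^2)_k}{(aq^2,q^2/a,q^2;q^2)_k}.$$ Then $$\sum_{k=0}^{n-1}\sum_{j=0}^{k}c_q(j)c_q(k-j)\equiv q^{(n-1)^2/2}[n]^2\pmod{[n]\Phi_n(q)(1-aq^n)(a-q^n)}.$$
   Context: Here $q$ and $a$ are indeterminates. The $q$-shifted factorial is $(x;q)_0=1$ and $(x;q)_m=(1-x)(1-xq)\cdots(1-xq^{m-1})$ for $m\geqslant1$, with $(x_1,\ldots,x_r;q)_m=(x_1;q)_m\cdots(x_r;q)_m$; the $q$-integer is $[m]=1+q+\cdots+q^{m-1}$; $\Phi_n(q)$ is the $n$-th cyclotomic polynomial. For rational functions $A,B$ in $q,a$ and a polynomial $P$ in $q,a$, $A\equiv B\pmod{P}$ means that $A-B=P\cdot U/V$ for polynomials $U,V$ with $V$ coprime to $P$. *)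

theory Defs
  imports Complex_Main "HOL-Computational_Algebra.Computational_Algebra"
begin

type_synonym pol2 = "int poly poly"
type_synonym rat2 = "int poly poly fract"

text \<open>
  Polynomials in the indeterminates \<open>q\<close>, \<open>a\<close> are elements of \<open>\<int>[q][a]\<close>: the inner polynomial
  variable is \<open>q\<close>, the outer one is \<open>a\<close>. Rational functions are elements of the fraction field.
  As the moduli considered are primitive, taking rational instead of integer coefficients in the
  congruence below would give the same relation (by Gauss's lemma).
\<close>

definition qP :: pol2 where "qP = [:[:0, 1:]:]"

definition aP :: pol2 where "aP = [:0, 1:]"

definition of_pol :: "pol2 \<Rightarrow> rat2" where "of_pol p = Fract p 1"

definition qR :: rat2 where "qR = of_pol qP"

definition aR :: rat2 where "aR = of_pol aP"

definition qpoch :: "'a::comm_ring_1 list \<Rightarrow> 'a \<Rightarrow> nat \<Rightarrow> 'a" where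
  "qpoch xs q m = (\<Prod>x\<leftarrow>xs. \<Prod>i<m. 1 - x * q ^ i)"

definition qint :: "'a::comm_ring_1 \<Rightarrow> nat \<Rightarrow> 'a" where
  "qint q m = (\<Sum>i<m. q ^ i)"

definition primitive_root_unity :: "nat \<Rightarrow> complex \<Rightarrow> bool" where
  "primitive_root_unity n z \<longleftrightarrow> z ^ n = 1 \<and> (\<forall>m. 0 < m \<and> m < n \<longrightarrow> z ^ m \<noteq> 1)"

text \<open>
  The integer polynomial whose complex roots are the primitive \<open>n\<close>-th roots of unity; for positive
  \<open>n\<close>, existence and uniqueness are shown in \<open>ex1_cyclotomic\<close> below.
\<close>

definition cyclotomic :: "nat \<Rightarrow> int poly" where
  "cyclotomic n =
     (THE p. map_poly of_int p = (\<Prod>z | primitive_root_unity n z. [:- z, 1:]))"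

text \<open>
  \<open>A \<equiv> B (mod P)\<close> for rational functions. Coprimality is that of the factorial ring
  \<open>\<int>[q, a]\<close> (only units as common divisors), not comaximality.
\<close>

definition rat_cong :: "rat2 \<Rightarrow> rat2 \<Rightarrow> pol2 \<Rightarrow> bool" where
  "rat_cong A B P \<longleftrightarrow>
     (\<exists>U V. V \<noteq> 0 \<and> coprime V P \<and> A - B = of_pol P * (of_pol U / of_pol V))"

definition cq :: "nat \<Rightarrow> rat2" where
  "cq k = (- 1) ^ k * qR ^ (k\<^sup>2) * qint qR (4 * k + 1) *
     (qpoch [aR * qR, qR / aR, qR] (qR\<^sup>2) k /
      qpoch [aR * qR\<^sup>2, qR\<^sup>2 / aR, qR\<^sup>2] (qR\<^sup>2) k)"

lemma of_int_poly_mult: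
  "map_poly (of_int :: int \<Rightarrow> 'a::idom) (p * r) = map_poly of_int p * map_poly of_int r"
  by (rule poly_eqI) (simp add: coeff_map_poly coeff_mult)

lemma of_int_poly_diff:
  "map_poly (of_int :: int \<Rightarrow> 'a::idom) (p - r) = map_poly of_int p - map_poly of_int r"
  by (rule poly_eqI) (simp add: coeff_map_poly)

lemma of_int_poly_add:
  "map_poly (of_int :: int \<Rightarrow> 'a::idom) (p + r) = map_poly of_int p + map_poly of_int r"
  by (rule poly_eqI) (simp add: coeff_map_poly)

lemma of_int_poly_prod:
  "map_poly (of_int :: int \<Rightarrow> 'a::idom) (prod f S) = (\<Prod>x\<in>S. map_poly of_int (f x))"
  by (induction S rule: infinite_finite_induct) (simp_all add: of_int_poly_mult)

lemma finite_primitive_root_unity: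
  assumes "n > 0"
  shows "finite {z. primitive_root_unity n z}"
  by (rule finite_subset[OF _ finite_roots_unity[where 'a = complex and n = n]])
     (use assms in \<open>auto simp: primitive_root_unity_def\<close>)

lemma roots_unity_factorization:
  assumes n: "n > 0"
  shows "(\<Prod>z | z ^ n = (1::complex). [:- z, 1:]) = monom 1 n - 1"
proof -
  let ?p = "monom 1 n - 1 :: complex poly"
  have deg: "degree ?p = n"
    unfolding diff_conv_add_uminus
    using n by (subst degree_add_eq_left) (simp_all add: degree_monom_eq)
  have p: "poly ?p z = z ^ n - 1" for z by (simp add: poly_monom)
  have "rsquarefree ?p"
    unfolding rsquarefree_roots
    using n by (auto simp: pderiv_diff pderiv_monom poly_monom power_0_left)
  hence "smult (lead_coeff ?p) (\<Prod>z | poly ?p z = 0. [:- z, 1:]) = ?p"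
    by (rule complex_poly_decompose_rsquarefree)
  moreover have "lead_coeff ?p = 1" using n deg by simp
  ultimately show ?thesis by (simp add: poly_monom)
qed

lemma roots_unity_partition:
  assumes n: "n > 0"
  shows "{z. z ^ n = (1::complex)} = (\<Union>d\<in>{d. d dvd n}. {z. primitive_root_unity d z})"
proof (intro equalityI subsetI)
  fix z :: complex assume "z \<in> {z. z ^ n = 1}"
  hence z: "z ^ n = 1" by simp
  define d where "d = (LEAST d. 0 < d \<and> z ^ d = 1)"
  have d: "0 < d \<and> z ^ d = 1" unfolding d_def by (rule LeastI) (use n z in auto)
  have least: "d \<le> m" if "0 < m" "z ^ m = 1" for m
    unfolding d_def by (rule Least_le) (use that in auto)
  have "z ^ n = (z ^ d) ^ (n div d) * z ^ (n mod d)"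
    by (simp flip: power_mult power_add)
  hence "z ^ (n mod d) = 1" using d z by simp
  hence "n mod d = 0" using least[of "n mod d"] d by (metis mod_less_divisor neq0_conv not_less)
  moreover have "primitive_root_unity d z"
    unfolding primitive_root_unity_def using d least by (meson leD)
  ultimately show "z \<in> (\<Union>d\<in>{d. d dvd n}. {z. primitive_root_unity d z})" by blast
next
  fix z :: complex assume "z \<in> (\<Union>d\<in>{d. d dvd n}. {z. primitive_root_unity d z})"
  then obtain d where "d dvd n" "z ^ d = 1" by (auto simp: primitive_root_unity_def)
  thus "z \<in> {z. z ^ n = 1}" by (elim dvdE) (simp add: power_mult)
qed

lemma primitive_root_unity_unique:
  assumes "primitive_root_unity d z" "primitive_root_unity e z" "d > 0" "e > 0"
  shows "d = e"
  using assms unfolding primitive_root_unity_def by (metis nat_neq_iff)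

lemma prod_primitive_roots:
  assumes n: "n > 0"
  shows "(\<Prod>d | d dvd n. \<Prod>z | primitive_root_unity d z. [:- z, 1:]) = monom 1 n - 1"
proof -
  have "(\<Prod>d | d dvd n. \<Prod>z | primitive_root_unity d z. [:- z, 1:]) =
        (\<Prod>z\<in>(\<Union>d\<in>{d. d dvd n}. {z. primitive_root_unity d z}). [:- z, 1:])"
  proof (rule prod.UNION_disjoint[symmetric])
    show "finite {d. d dvd n}" using n by simp
    show "\<forall>d\<in>{d. d dvd n}. finite {z. primitive_root_unity d z}"
      using n finite_primitive_root_unity dvd_pos_nat by blast
    show "\<forall>d\<in>{d. d dvd n}. \<forall>e\<in>{d. d dvd n}. d \<noteq> e \<longrightarrow>
            {z. primitive_root_unity d z} \<inter> {z. primitive_root_unity e z} = {}"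
      using n primitive_root_unity_unique dvd_pos_nat by blast
  qed
  thus ?thesis using roots_unity_factorization[OF n] roots_unity_partition[OF n] by simp
qed

lemma ex_cyclotomic:
  assumes "n > 0"
  shows "\<exists>p. map_poly of_int p = (\<Prod>z | primitive_root_unity n z. [:- z, 1:])"
  using assms
proof (induction n rule: less_induct)
  case (less n)
  let ?C = "\<lambda>d. \<Prod>z | primitive_root_unity d z. [:- z, 1:]"
  let ?D = "{d. d dvd n} - {n}"
  have "\<forall>d\<in>?D. \<exists>p. map_poly of_int p = ?C d"
  proof
    fix d assume "d \<in> ?D"
    hence "0 < d" "d < n"
      using less.prems by (auto simp: dvd_pos_nat intro: le_neq_implies_less dvd_imp_le)
    thus "\<exists>p. map_poly of_int p = ?C d" by (intro less.IH)
  qed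
  then obtain f where f: "\<And>d. d \<in> ?D \<Longrightarrow> map_poly of_int (f d) = ?C d"
    by metis
  define g where "g = prod f ?D"
  have g: "map_poly of_int g = (\<Prod>d\<in>?D. ?C d)"
    unfolding g_def of_int_poly_prod by (rule prod.cong) (use f in auto)
  have "lead_coeff (map_poly of_int g :: complex poly) = 1"
    unfolding g lead_coeff_prod by (intro prod.neutral ballI) simp
  moreover have deg_of_int: "degree (map_poly of_int p :: complex poly) = degree p" for p
    by (rule degree_map_poly) simp
  ultimately have lc: "lead_coeff g = 1" by (simp add: coeff_map_poly)
  hence g0: "g \<noteq> 0" by auto
  obtain s r where sr: "pseudo_divmod (monom 1 n - 1) g = (s, r)" by force
  from pseudo_divmod[OF g0 this] lc
  have eq: "monom 1 n - 1 = g * s + r" and r: "r = 0 \<or> degree r < degree g" by auto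
  have fin: "finite {d. d dvd n}" using less.prems by simp
  have "map_poly of_int (monom 1 n - 1 :: int poly) = (monom 1 n - 1 :: complex poly)"
    by (simp add: of_int_poly_diff map_poly_monom)
  also have "\<dots> = ?C n * map_poly of_int g"
    unfolding g prod_primitive_roots[OF less.prems, symmetric]
    by (rule prod.remove) (use fin in auto)
  finally have "map_poly of_int g * map_poly of_int s + map_poly of_int r
      = ?C n * map_poly of_int g"
    by (simp add: eq of_int_poly_mult of_int_poly_add)
  hence r': "map_poly of_int r = map_poly of_int g * (?C n - map_poly of_int s)"
    by (simp add: algebra_simps)
  have "?C n - map_poly of_int s = 0"
  proof (rule ccontr)
    assume nz: "?C n - map_poly of_int s \<noteq> 0"
    have g0': "map_poly of_int g \<noteq> (0 :: complex poly)"
      using lc by (metis deg_of_int coeff_map_poly coeff_0 of_int_0 of_int_1 zero_neq_one)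
    have "degree (map_poly of_int r :: complex poly) \<ge> degree g"
      unfolding r' using nz g0' by (simp add: degree_mult_eq deg_of_int)
    moreover have "r \<noteq> 0" using r' nz g0' by auto
    ultimately show False using r by (simp add: deg_of_int)
  qed
  thus ?case by (intro exI[of _ s]) simp
qed

lemma ex1_cyclotomic:
  assumes "n > 0"
  shows "\<exists>!p. map_poly of_int p = (\<Prod>z | primitive_root_unity n z. [:- z, 1:])"
proof -
  have "p = r" if "map_poly of_int p = (map_poly of_int r :: complex poly)" for p r
    using that by (auto simp: poly_eq_iff coeff_map_poly)
  thus ?thesis using ex_cyclotomic[OF assms] by metis
qed

lemma map_poly_cyclotomic:
  assumes "n > 0"
  shows "map_poly of_int (cyclotomic n) = (\<Prod>z | primitive_root_unity n z. [:- z, 1:])"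
  unfolding cyclotomic_def by (rule theI'[OF ex1_cyclotomic[OF assms]])

end

theory Submission
  imports Defs
begin

text \<open>
  Put \<open>T x = \<Sum>i<x. cq i\<close>, so that the double sum is \<open>S = \<Sum>j<n. cq j * T (n - j)\<close>, and let
  \<open>n = 2 * M + 1\<close>. The congruence is checked at complex points on the components of the modulus.

  For \<open>a = q\<^sup>n\<close> and \<open>a = 1/q\<^sup>n\<close> the terms with \<open>k > M\<close> vanish, hence \<open>S = (T (M + 1))\<^sup>2\<close>, and the
  terminating sum \<open>T (M + 1)\<close> is evaluated by the WZ method.

  If \<open>q\<close> is a primitive \<open>d\<close>-th root of unity with \<open>d\<close> odd, \<open>1 < d\<close> and \<open>d\<close> dividing \<open>n\<close>, then
  \<open>cq (l d + r)\<close> is a multiple of \<open>cq r\<close> by a factor depending on \<open>l\<close> only, \<open>cq r = 0\<close> for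
  \<open>(d - 1)/2 < r < d\<close>, and \<open>cq ((d - 1)/2 - r) = - cq r\<close>; so every summand \<open>cq j * T (n - j)\<close> vanishes.

  For the second factor \<open>\<Phi>\<^sub>n\<close> one writes \<open>S = (T (M + 1))\<^sup>2 + 2 * (\<Sum>M<j<n. cq j * T (n - j))\<close>. The square
  is divisible by \<open>\<Phi>\<^sub>n\<close> twice; in the second sum each \<open>cq j\<close> is divisible by \<open>\<Phi>\<^sub>n\<close>, and modulo \<open>\<Phi>\<^sub>n\<close> the
  reflection \<open>j \<mapsto> 3 * M + 1 - j\<close> changes the sign of \<open>cq j / \<Phi>\<^sub>n\<close> and fixes \<open>T (n - j)\<close>.
\<close>

section \<open>Rational functions and their values at complex points\<close>

lemma of_pol_add: "of_pol (p + r) = of_pol p + of_pol r"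
  and of_pol_diff: "of_pol (p - r) = of_pol p - of_pol r"
  and of_pol_mult: "of_pol (p * r) = of_pol p * of_pol r"
  and of_pol_0: "of_pol 0 = 0"
  and of_pol_1: "of_pol 1 = 1"
  by (simp_all add: of_pol_def fract_collapse)

lemma of_pol_minus: "of_pol (- p) = - of_pol p"
  by (simp add: of_pol_def)

lemmas of_pol_hom = of_pol_add of_pol_diff of_pol_minus of_pol_mult of_pol_0 of_pol_1

lemma of_pol_eq_iff: "of_pol p = of_pol r \<longleftrightarrow> p = r"
  by (simp add: of_pol_def eq_fract)

lemma of_pol_eq_0_iff: "of_pol p = 0 \<longleftrightarrow> p = 0"
  using of_pol_eq_iff[of p 0] by (simp add: of_pol_0)

lemma of_pol_power: "of_pol (p ^ m) = of_pol p ^ m"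
  by (induction m) (simp_all add: of_pol_hom)

lemma of_pol_sum: "of_pol (sum f S) = (\<Sum>x\<in>S. of_pol (f x))"
  by (induction S rule: infinite_finite_induct) (simp_all add: of_pol_hom)

lemma of_pol_prod: "of_pol (prod f S) = (\<Prod>x\<in>S. of_pol (f x))"
  by (induction S rule: infinite_finite_induct) (simp_all add: of_pol_hom)

section \<open>Congruences of rational functions\<close>

lemma rat2_coprime_repr:
  obtains A B where "coprime A B" "B \<noteq> 0" "x = of_pol A / of_pol B"
proof -
  obtain a b where x: "x = Fract a b" and b: "b \<noteq> 0" by (cases x)
  define g where "g = gcd a b"
  have g: "g \<noteq> 0" using b by (simp add: g_def)
  obtain A B where AB: "a = A * g" "b = B * g" "coprime A B"
    using gcd_coprime_exists[of a b] g unfolding g_def by blast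
  have "x = of_pol A / of_pol B"
    using AB b g by (simp add: x of_pol_def divide_fract eq_fract)
  moreover have "B \<noteq> 0" using AB b by auto
  ultimately show ?thesis using that AB by blast
qed

text \<open>A denominator coprime to \<open>P\<close> can absorb no factor of \<open>P\<close>, so
  only the numerator in lowest terms matters. This allows coprime moduli to be multiplied.\<close>

lemma rat_cong_iff_dvd:
  assumes "coprime A B" "B \<noteq> 0" "x - y = of_pol A / of_pol B"
  shows "rat_cong x y P \<longleftrightarrow> P dvd A"
proof
  assume "rat_cong x y P"
  then obtain U V where V: "V \<noteq> 0" "coprime V P" and eq: "x - y = of_pol P * (of_pol U / of_pol V)"
    unfolding rat_cong_def by blast
  have "of_pol (A * V) = of_pol (P * U * B)"
    using eq V(1) assms(2,3) by (simp add: of_pol_hom of_pol_eq_0_iff field_simps)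
  hence "P dvd A * V" unfolding of_pol_eq_iff by simp
  thus "P dvd A" using V(2) by (metis coprime_commute coprime_dvd_mult_left_iff)
next
  assume "P dvd A"
  then obtain U where U: "A = P * U" by (elim dvdE)
  have "coprime B P" using assms(1) U by (simp add: coprime_commute)
  thus "rat_cong x y P"
    unfolding rat_cong_def by (intro exI[of _ U] exI[of _ B]) (use assms U in \<open>auto simp: of_pol_hom\<close>)
qed

lemma rat_cong_mult_moduli:
  assumes "rat_cong x y P" "rat_cong x y Q" "coprime P Q"
  shows "rat_cong x y (P * Q)"
proof -
  obtain A B where AB: "coprime A B" "B \<noteq> 0" "x - y = of_pol A / of_pol B"
    by (rule rat2_coprime_repr)
  show ?thesis using assms unfolding rat_cong_iff_dvd[OF AB] by (simp add: divides_mult)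
qed

lemma rat_cong_refl: "rat_cong x x P"
  unfolding rat_cong_def by (intro exI[of _ 0] exI[of _ 1]) (simp add: of_pol_hom)

lemma rat_cong_0_add:
  assumes "rat_cong x 0 P" "rat_cong y 0 P"
  shows "rat_cong (x + y) 0 P"
proof -
  obtain U V where V: "V \<noteq> 0" "coprime V P" "x = of_pol P * (of_pol U / of_pol V)"
    using assms(1) unfolding rat_cong_def by auto
  obtain U' V' where V': "V' \<noteq> 0" "coprime V' P" "y = of_pol P * (of_pol U' / of_pol V')"
    using assms(2) unfolding rat_cong_def by auto
  have "V * V' \<noteq> 0" "coprime (V * V') P" using V V' by simp_all
  moreover have "x + y - 0 = of_pol P * (of_pol (U * V' + U' * V) / of_pol (V * V'))"
    using V V' by (simp add: of_pol_hom of_pol_eq_0_iff field_simps)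
  ultimately show ?thesis unfolding rat_cong_def by blast
qed

text \<open>Each factor contributes one \<open>P\<close>; this is the source of the modulus
  Phi_n^2.\<close>

lemma rat_cong_0_mult:
  assumes "rat_cong x 0 P" "rat_cong y 0 P"
  shows "rat_cong (x * y) 0 (P * P)"
proof -
  obtain U V where V: "V \<noteq> 0" "coprime V P" "x = of_pol P * (of_pol U / of_pol V)"
    using assms(1) unfolding rat_cong_def by auto
  obtain U' V' where V': "V' \<noteq> 0" "coprime V' P" "y = of_pol P * (of_pol U' / of_pol V')"
    using assms(2) unfolding rat_cong_def by auto
  have "V * V' \<noteq> 0" "coprime (V * V') (P * P)" using V V' by simp_all
  moreover have "x * y - 0 = of_pol (P * P) * (of_pol (U * U') / of_pol (V * V'))"
    using V V' by (simp add: of_pol_hom)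
  ultimately show ?thesis unfolding rat_cong_def by blast
qed

lemma rat_cong_0_of_pol:
  assumes "P dvd p"
  shows "rat_cong (of_pol p) 0 P"
proof -
  obtain U where "p = P * U" using assms by (elim dvdE)
  thus ?thesis unfolding rat_cong_def by (intro exI[of _ U] exI[of _ 1]) (simp add: of_pol_hom)
qed

lemma rat_cong_0_diff:
  assumes "rat_cong x 0 P" "rat_cong y 0 P"
  shows "rat_cong x y P"
proof -
  have "rat_cong (- y) 0 P"
  proof -
    obtain U V where V: "V \<noteq> 0" "coprime V P" "y = of_pol P * (of_pol U / of_pol V)"
      using assms(2) unfolding rat_cong_def by auto
    hence "- y - 0 = of_pol P * (of_pol (- U) / of_pol V)" by (simp add: of_pol_minus)
    thus ?thesis unfolding rat_cong_def using V by blast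
  qed
  from rat_cong_0_add[OF assms(1) this] show ?thesis unfolding rat_cong_def by simp
qed

section \<open>Evaluation at complex points\<close>

definition ipoly :: "int poly \<Rightarrow> complex \<Rightarrow> complex" where
  "ipoly p z = poly (map_poly of_int p) z"

definition ev :: "complex \<Rightarrow> complex \<Rightarrow> pol2 \<Rightarrow> complex" where
  "ev z w p = poly (map_poly (\<lambda>c. ipoly c z) p) w"

lemma ipoly_0 [simp]: "ipoly 0 z = 0"
  and ipoly_1 [simp]: "ipoly 1 z = 1"
  and ipoly_add: "ipoly (p + r) z = ipoly p z + ipoly r z"
  and ipoly_mult: "ipoly (p * r) z = ipoly p z * ipoly r z"
  and ipoly_pCons [simp]: "ipoly (pCons c p) z = of_int c + z * ipoly p z"
  by (simp_all add: ipoly_def of_int_poly_mult of_int_poly_add map_poly_pCons)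

lemma ipoly_sum: "ipoly (sum f S) z = (\<Sum>x\<in>S. ipoly (f x) z)"
  by (induction S rule: infinite_finite_induct) (simp_all add: ipoly_add)

lemma ipoly_power: "ipoly (p ^ m) z = ipoly p z ^ m"
  by (induction m) (simp_all add: ipoly_mult)

lemma ipoly_minus: "ipoly (- p) z = - ipoly p z"
  using ipoly_add[of p "- p" z] by (simp add: add_eq_0_iff)

lemma ev_pCons: "ev z w (pCons c p) = ipoly c z + w * ev z w p"
  by (simp add: ev_def map_poly_pCons)

lemma ev_0 [simp]: "ev z w 0 = 0" and ev_1 [simp]: "ev z w 1 = 1"
  by (simp_all add: ev_def)

lemma ev_add: "ev z w (p + r) = ev z w p + ev z w r"
proof -
  have "map_poly (\<lambda>c. ipoly c z) (p + r) = map_poly (\<lambda>c. ipoly c z) p + map_poly (\<lambda>c. ipoly c z) r"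
    by (rule poly_eqI) (simp add: coeff_map_poly ipoly_add)
  thus ?thesis by (simp add: ev_def)
qed

lemma ev_mult: "ev z w (p * r) = ev z w p * ev z w r"
proof -
  have "map_poly (\<lambda>c. ipoly c z) (p * r) = map_poly (\<lambda>c. ipoly c z) p * map_poly (\<lambda>c. ipoly c z) r"
    by (rule poly_eqI) (simp add: coeff_map_poly coeff_mult ipoly_mult ipoly_sum)
  thus ?thesis by (simp add: ev_def)
qed

lemma ev_diff: "ev z w (p - r) = ev z w p - ev z w r"
  using ev_add[of z w "p - r" r] by simp

lemma ev_minus: "ev z w (- p) = - ev z w p"
  using ev_diff[of z w 0 p] by simp

lemma ev_qP [simp]: "ev z w qP = z" and ev_aP [simp]: "ev z w aP = w"
  by (simp_all add: qP_def aP_def ev_pCons)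

text \<open>
  A rational function may have a value at a zero of the denominator of a given representation; this
  is what happens for \<open>cq k\<close> with \<open>k \<ge> d\<close> at \<open>d\<close>-th roots of unity.
\<close>

definition has_val :: "complex \<Rightarrow> complex \<Rightarrow> rat2 \<Rightarrow> complex \<Rightarrow> bool" where
  "has_val z w x v \<longleftrightarrow>
     (\<exists>U V. x = of_pol U / of_pol V \<and> ev z w V \<noteq> 0 \<and> v = ev z w U / ev z w V)"

lemma has_val_of_pol: "has_val z w (of_pol p) (ev z w p)"
  unfolding has_val_def by (intro exI[of _ p] exI[of _ 1]) (simp add: of_pol_hom)

lemma has_val_of_pol': "ev z w p = v \<Longrightarrow> has_val z w (of_pol p) v"
  using has_val_of_pol by blast

lemma has_val_0: "has_val z w 0 0" and has_val_1: "has_val z w 1 1"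
  using has_val_of_pol[of z w 0] has_val_of_pol[of z w 1] by (simp_all add: of_pol_hom)

lemma has_val_qR: "has_val z w qR z" and has_val_aR: "has_val z w aR w"
  unfolding qR_def aR_def by (rule has_val_of_pol'; simp)+

lemma has_val_add:
  assumes "has_val z w x v" "has_val z w x' v'"
  shows "has_val z w (x + x') (v + v')"
proof -
  obtain U V where 1: "x = of_pol U / of_pol V" "ev z w V \<noteq> 0" "v = ev z w U / ev z w V"
    using assms(1) unfolding has_val_def by blast
  obtain U' V' where 2: "x' = of_pol U' / of_pol V'" "ev z w V' \<noteq> 0" "v' = ev z w U' / ev z w V'"
    using assms(2) unfolding has_val_def by blast
  have V: "V \<noteq> 0" "V' \<noteq> 0" using 1 2 by auto
  have "x + x' = of_pol (U * V' + U' * V) / of_pol (V * V')"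
    using 1 2 V by (simp add: of_pol_hom of_pol_eq_0_iff add_frac_eq)
  moreover have "v + v' = ev z w (U * V' + U' * V) / ev z w (V * V')" "ev z w (V * V') \<noteq> 0"
    using 1 2 by (simp_all add: ev_add ev_mult add_frac_eq)
  ultimately show ?thesis unfolding has_val_def by blast
qed

lemma has_val_mult:
  assumes "has_val z w x v" "has_val z w x' v'"
  shows "has_val z w (x * x') (v * v')"
proof -
  obtain U V where 1: "x = of_pol U / of_pol V" "ev z w V \<noteq> 0" "v = ev z w U / ev z w V"
    using assms(1) unfolding has_val_def by blast
  obtain U' V' where 2: "x' = of_pol U' / of_pol V'" "ev z w V' \<noteq> 0" "v' = ev z w U' / ev z w V'"
    using assms(2) unfolding has_val_def by blast
  have "x * x' = of_pol (U * U') / of_pol (V * V')"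
    using 1 2 by (simp add: of_pol_hom)
  moreover have "v * v' = ev z w (U * U') / ev z w (V * V')" "ev z w (V * V') \<noteq> 0"
    using 1 2 by (simp_all add: ev_mult)
  ultimately show ?thesis unfolding has_val_def by blast
qed

lemma has_val_inverse:
  assumes "has_val z w x v" "v \<noteq> 0"
  shows "has_val z w (inverse x) (inverse v)"
proof -
  obtain U V where 1: "x = of_pol U / of_pol V" "ev z w V \<noteq> 0" "v = ev z w U / ev z w V"
    using assms(1) unfolding has_val_def by blast
  thus ?thesis unfolding has_val_def using assms(2)
    by (intro exI[of _ V] exI[of _ U]) (auto simp: field_simps)
qed

lemma has_val_divide:
  assumes "has_val z w x v" "has_val z w x' v'" "v' \<noteq> 0"
  shows "has_val z w (x / x') (v / v')"
  unfolding divide_inverse by (intro has_val_mult has_val_inverse assms)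

lemma has_val_minus: "has_val z w x v \<Longrightarrow> has_val z w (- x) (- v)"
  using has_val_mult[OF has_val_of_pol[of z w "- 1"], of x v]
  by (simp add: of_pol_hom ev_minus)

lemma has_val_diff:
  "has_val z w x v \<Longrightarrow> has_val z w x' v' \<Longrightarrow> has_val z w (x - x') (v - v')"
  using has_val_add[OF _ has_val_minus] by fastforce

lemma has_val_power: "has_val z w x v \<Longrightarrow> has_val z w (x ^ m) (v ^ m)"
  by (induction m) (auto intro: has_val_1 has_val_mult)

lemma has_val_sum:
  "(\<And>i. i \<in> S \<Longrightarrow> has_val z w (f i) (g i)) \<Longrightarrow> has_val z w (sum f S) (sum g S)"
  by (induction S rule: infinite_finite_induct) (auto intro: has_val_0 has_val_add)

lemma has_val_prod:
  "(\<And>i. i \<in> S \<Longrightarrow> has_val z w (f i) (g i)) \<Longrightarrow> has_val z w (prod f S) (prod g S)"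
  by (induction S rule: infinite_finite_induct) (auto intro: has_val_1 has_val_mult)

lemmas has_val_intros = has_val_0 has_val_1 has_val_qR has_val_aR has_val_add has_val_diff
  has_val_minus has_val_mult has_val_power has_val_sum has_val_prod has_val_divide

text \<open>Two representations give \<open>A * V = U * B\<close> as polynomials, which can be
  evaluated even where \<open>B\<close> vanishes; so a value 0 forces a zero of the
  numerator.\<close>

lemma has_val_numerator:
  assumes "has_val z w (of_pol A / of_pol B) v" "B \<noteq> 0"
  shows "ev z w A = v * ev z w B"
proof -
  obtain U V where 1: "of_pol A / of_pol B = of_pol U / of_pol V" "ev z w V \<noteq> 0"
      "v = ev z w U / ev z w V"
    using assms(1) unfolding has_val_def by blast
  have "V \<noteq> 0" using 1 by auto
  hence "of_pol (A * V) = of_pol (U * B)"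
    using 1 assms(2) by (simp add: of_pol_hom of_pol_eq_0_iff field_simps)
  hence "A * V = U * B" unfolding of_pol_eq_iff .
  hence "ev z w A * ev z w V = ev z w U * ev z w B" by (metis ev_mult)
  hence "ev z w A = ev z w U * ev z w B / ev z w V" using 1(2) by (simp add: eq_divide_eq)
  thus ?thesis using 1(3) by simp
qed

lemma has_val_unique:
  assumes "has_val z w x v" "has_val z w x v'"
  shows "v = v'"
proof -
  obtain U V where 1: "x = of_pol U / of_pol V" "ev z w V \<noteq> 0" "v = ev z w U / ev z w V"
    using assms(1) unfolding has_val_def by blast
  have "V \<noteq> 0" using 1 by auto
  with has_val_numerator[of z w U V v'] 1 assms(2) show ?thesis by simp
qed

section \<open>From values at points to congruences\<close>

lemma coprime_pol2I:
  assumes unit: "is_unit (coeff F i)" and c: "c \<noteq> 0" and comb: "s * F + t * G = [:c:]"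
  shows "coprime F (G :: pol2)"
proof (rule coprimeI)
  fix h assume h: "h dvd F" "h dvd G"
  hence "h dvd [:c:]" unfolding comb[symmetric] by simp
  \<comment> \<open>A divisor of a nonzero element of Z[q] is itself constant in \<open>a\<close>;
    hence it divides every coefficient of \<open>F\<close>, among them a unit.\<close>
  hence "degree h \<le> degree [:c:]" by (rule dvd_imp_degree_le) (use c in auto)
  then obtain h0 where h0: "h = [:h0:]" by (metis degree_pCons_0 le_zero_eq degree_eq_zeroE)
  hence "h0 dvd coeff F i" using h(1) by (simp add: const_poly_dvd_iff)
  hence "is_unit h0" using unit by (metis dvd_trans)
  thus "is_unit h" unfolding h0 by (simp add: is_unit_const_poly_iff)
qed

lemma map_poly_of_int_eq_iff:
  "map_poly of_int p = (map_poly of_int r :: complex poly) \<longleftrightarrow> p = r"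
  by (auto simp: poly_eq_iff coeff_map_poly)

lemma degree_of_int_poly: "degree (map_poly of_int p :: complex poly) = degree p"
  by (rule degree_map_poly) simp

text \<open>A common divisor of positive degree would have a complex root; a constant one divides
  the leading coefficient 1.\<close>

lemma coprime_int_polyI:
  assumes monic: "lead_coeff f = 1" and noroot: "\<And>z. ipoly f z = 0 \<Longrightarrow> ipoly g z = 0 \<Longrightarrow> False"
  shows "coprime f g"
proof (rule coprimeI)
  fix h assume h: "h dvd f" "h dvd g"
  have f0: "f \<noteq> 0" using monic by auto
  have "degree h = 0"
  proof (rule ccontr)
    assume "degree h \<noteq> 0"
    hence "\<not> constant (poly (map_poly of_int h :: complex poly))"
      by (simp add: constant_degree degree_of_int_poly)
    then obtain z where "ipoly h z = 0"
      unfolding ipoly_def using fundamental_theorem_of_algebra by blast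
    hence "ipoly f z = 0" "ipoly g z = 0" using h by (auto simp: dvd_def ipoly_mult)
    thus False by (rule noroot)
  qed
  then obtain h0 where h0: "h = [:h0:]" by (rule degree_eq_zeroE)
  hence "h0 dvd coeff f (degree f)" using h(1) by (simp add: const_poly_dvd_iff)
  thus "is_unit h" unfolding h0 monic by (simp add: is_unit_const_poly_iff)
qed

text \<open>Division with remainder by a monic polynomial stays over the integers; over the complex
  numbers the remainder is a multiple of \<open>f\<close> of smaller degree, hence 0.\<close>

lemma monic_int_poly_dvdI:
  assumes monic: "lead_coeff f = 1"
    and dvd: "(map_poly of_int f :: complex poly) dvd map_poly of_int g"
  shows "f dvd g"
proof -
  have f0: "f \<noteq> 0" using monic by auto
  obtain s r where sr: "pseudo_divmod g f = (s, r)" by force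
  from pseudo_divmod[OF f0 this] monic
  have eq: "g = f * s + r" and r: "r = 0 \<or> degree r < degree f" by auto
  have "map_poly of_int g = map_poly of_int f * map_poly of_int s + (map_poly of_int r :: complex poly)"
    by (simp add: eq of_int_poly_mult of_int_poly_add)
  hence *: "(map_poly of_int f :: complex poly) dvd map_poly of_int r"
    using dvd by (metis dvd_add_right_iff dvd_triv_left)
  have "r = 0"
  proof (rule ccontr)
    assume "r \<noteq> 0"
    hence "map_poly of_int r \<noteq> (0 :: complex poly)"
      using map_poly_of_int_eq_iff[of r 0] by simp
    from dvd_imp_degree_le[OF * this] show False
      using r \<open>r \<noteq> 0\<close> by (simp add: degree_of_int_poly)
  qed
  thus ?thesis using eq by simp
qed

lemma prod_linear_dvdI:
  fixes p :: "complex poly"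
  assumes "finite Z" "\<And>z. z \<in> Z \<Longrightarrow> poly p z = 0"
  shows "(\<Prod>z\<in>Z. [:- z, 1:]) dvd p"
  using assms
proof (induction Z arbitrary: p)
  case (insert z Z)
  then obtain r where r: "p = [:- z, 1:] * r" by (metis dvdE insertI1 poly_eq_0_iff_dvd)
  have "poly r x = 0" if "x \<in> Z" for x
    using insert.prems[of x] insert.hyps that unfolding r by auto
  hence "(\<Prod>z\<in>Z. [:- z, 1:]) dvd r" by (rule insert.IH)
  hence "[:- z, 1:] * (\<Prod>z\<in>Z. [:- z, 1:]) dvd p" unfolding r by (intro mult_dvd_mono dvd_refl)
  thus ?case using insert.hyps by simp
qed simp

text \<open>At a root \<open>z\<close> of \<open>f\<close> the numerator becomes a polynomial in
  \<open>a\<close> with infinitely many zeros, so all its coefficients vanish at \<open>z\<close>.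
  The roots of \<open>f\<close> are simple, hence \<open>f\<close> divides each coefficient.\<close>

lemma rat_cong_const_poly:
  assumes f: "map_poly of_int f = (\<Prod>z\<in>Z. [:- z, 1:])" and fin: "finite Z"
    and val: "\<And>z. z \<in> Z \<Longrightarrow> infinite {w. has_val z w (x - y) 0}"
  shows "rat_cong x y [:f:]"
proof -
  obtain A B where AB: "coprime A B" "B \<noteq> 0" "x - y = of_pol A / of_pol B"
    by (rule rat2_coprime_repr)
  have "lead_coeff (map_poly of_int f :: complex poly) = 1"
    unfolding f lead_coeff_prod by simp
  hence monic: "lead_coeff f = 1" by (simp add: degree_of_int_poly coeff_map_poly)
  have "f dvd coeff A i" for i
  proof (rule monic_int_poly_dvdI[OF monic], unfold f, rule prod_linear_dvdI[OF fin])
    fix z assume z: "z \<in> Z"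
    have "{w. has_val z w (x - y) 0} \<subseteq> {w. ev z w A = 0}"
      using has_val_numerator[of z _ A B 0] AB by auto
    hence "infinite {w. poly (map_poly (\<lambda>c. ipoly c z) A) w = 0}"
      using val[OF z] unfolding ev_def by (meson finite_subset)
    hence "map_poly (\<lambda>c. ipoly c z) A = 0" using poly_roots_finite by blast
    hence "coeff (map_poly (\<lambda>c. ipoly c z) A) i = 0" by simp
    thus "poly (map_poly of_int (coeff A i)) z = 0"
      by (simp add: coeff_map_poly ipoly_def)
  qed
  thus ?thesis unfolding rat_cong_iff_dvd[OF AB] const_poly_dvd_iff by blast
qed

text \<open>The remainder of the numerator modulo a polynomial linear in \<open>a\<close> lies in
  Z[q] and vanishes at infinitely many points, hence is 0. The power of \<open>v\<close> introduced
  by pseudo-division is removed by coprimality.\<close>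

lemma rat_cong_linear:
  assumes unit: "is_unit u \<or> is_unit v" and v: "v \<noteq> 0"
    and val: "infinite {z. \<exists>w. ev z w [:u, v:] = 0 \<and> has_val z w (x - y) 0}"
  shows "rat_cong x y [:u, v:]"
proof -
  obtain A B where AB: "coprime A B" "B \<noteq> 0" "x - y = of_pol A / of_pol B"
    by (rule rat2_coprime_repr)
  let ?g = "[:u, v:]"
  have g0: "?g \<noteq> 0" using v by simp
  obtain s r where sr: "pseudo_divmod A ?g = (s, r)" by force
  define k where "k = Suc (degree A) - degree ?g"
  from pseudo_divmod[OF g0 sr]
  have eq: "smult (v ^ k) A = ?g * s + r" and r: "r = 0 \<or> degree r < degree ?g"
    using v by (auto simp: k_def)
  then obtain r0 where r0: "r = [:r0:]" using v by (metis degree_eq_zeroE degree_pCons_eq degree_0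
        less_one pCons_0_0 One_nat_def degree_pCons_0 pCons_eq_0_iff)
  have "{z. \<exists>w. ev z w ?g = 0 \<and> has_val z w (x - y) 0} \<subseteq> {z. ipoly r0 z = 0}"
  proof safe
    fix z w assume w: "ev z w ?g = 0" "has_val z w (x - y) 0"
    hence "ev z w A = 0" using has_val_numerator[of z w A B 0] AB by simp
    moreover have "ev z w ([:v ^ k:] * A) = ev z w (?g * s + [:r0:])" using eq r0 by simp
    ultimately show "ipoly r0 z = 0"
      using w(1) unfolding ev_add ev_mult by (simp add: ev_pCons)
  qed
  hence "infinite {z. poly (map_poly of_int r0 :: complex poly) z = 0}"
    using val unfolding ipoly_def by (meson finite_subset)
  hence "map_poly of_int r0 = (0 :: complex poly)" using poly_roots_finite by blast
  hence "r0 = 0" using map_poly_of_int_eq_iff[of r0 0] by simp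
  hence "[:v ^ k:] * A = ?g * s" using eq r0 by simp
  hence dvd: "?g dvd [:v ^ k:] * A" by (metis dvd_triv_left)
  have "is_unit (coeff ?g 0) \<or> is_unit (coeff ?g 1)" using unit by simp
  then obtain i where "is_unit (coeff ?g i)" by blast
  hence "coprime ?g [:v ^ k:]"
    by (rule coprime_pol2I[where s = 0 and t = 1 and c = "v ^ k"]) (use v in auto)
  with dvd show ?thesis
    unfolding rat_cong_iff_dvd[OF AB] using coprime_dvd_mult_right_iff by blast
qed

section \<open>Evaluation of the terminating sum\<close>

text \<open>
  The quotient of the \<open>q\<close>-shifted factorials in \<open>cq (Suc k)\<close> and \<open>cq k\<close> is
  \<open>wpf a q (2 * k + 1) / wpf a q (2 * k + 2)\<close>.
\<close>

definition wpf :: "'a::field \<Rightarrow> 'a \<Rightarrow> nat \<Rightarrow> 'a" where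
  "wpf a q e = (1 - a * q ^ e) * (1 - q ^ e / a) * (1 - q ^ e)"

text \<open>The symmetry that lets the points a = q^n and a = q^(-n) be treated together.\<close>

lemma wpf_inverse: "wpf (inverse a) q e = wpf a q e"
  by (simp add: wpf_def divide_inverse mult.commute)

lemma wpf_mult:
  assumes "a \<noteq> 0"
  shows "a * wpf a q e = (1 - a * q ^ e) * (a - q ^ e) * (1 - q ^ e)"
proof -
  have "a * (1 - q ^ e / a) = a - q ^ e" using assms by (simp add: right_diff_distrib)
  moreover have "a * wpf a q e = (1 - a * q ^ e) * (a * (1 - q ^ e / a)) * (1 - q ^ e)"
    unfolding wpf_def by (simp only: mult_ac)
  ultimately show ?thesis by simp
qed

text \<open>Induction step of \<open>sx_shift\<close>, with \<open>x\<close> for q^(2M+1) and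
  \<open>y\<close> for q^(2k); \<open>s\<close>, \<open>s'\<close> are the terms for
  \<open>M\<close>, \<open>M + 1\<close> at index \<open>k\<close>, and \<open>s1\<close>,
  \<open>s1'\<close> those at \<open>k + 1\<close>.\<close>

lemma wpf_shift_identity:
  fixes x q y s s' :: "'a::field"
  assumes nz: "x - y \<noteq> 0" "1 - q\<^sup>2 * y \<noteq> 0" "1 - x * q\<^sup>2 * y \<noteq> 0"
    and IH: "(1 - x) * s' * (x * q - y) * (1 - x * q\<^sup>2 * y) = (1 - x * q\<^sup>2) * (1 - x * q * y) * (x - y) * s"
    and s: "s1 * ((1 - x * q\<^sup>2 * y) * (x - q\<^sup>2 * y) * (1 - q\<^sup>2 * y)) =
      - q * y * ((1 - x * q * y) * (x - q * y) * (1 - q * y)) * s"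
    and s': "s1' * ((1 - x * q ^ 4 * y) * (x - y) * (1 - q\<^sup>2 * y)) * q =
      - q * y * ((1 - x * q ^ 3 * y) * (x * q - y) * (1 - q * y)) * s'"
  shows "(1 - x) * s1' * (x * q - q\<^sup>2 * y) * (1 - x * q ^ 4 * y)
    = (1 - x * q\<^sup>2) * (1 - x * q ^ 3 * y) * (x - q\<^sup>2 * y) * s1"
proof -
  define D where "D = (x - y) * (1 - q\<^sup>2 * y) * (1 - x * q\<^sup>2 * y)"
  have "((1 - x) * s1' * (x * q - q\<^sup>2 * y) * (1 - x * q ^ 4 * y)) * D
     = (1 - x) * (x - q * y) * (1 - x * q\<^sup>2 * y) * (s1' * ((1 - x * q ^ 4 * y) * (x - y) * (1 - q\<^sup>2 * y)) * q)"
    unfolding D_def by (simp add: algebra_simps power2_eq_square)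
  also have "\<dots> = (x - q * y) * (- q * y * (1 - x * q ^ 3 * y) * (1 - q * y)) *
      ((1 - x) * s' * (x * q - y) * (1 - x * q\<^sup>2 * y))"
    unfolding s' by (simp only: mult_ac)
  also have "\<dots> = (1 - x * q\<^sup>2) * (1 - x * q ^ 3 * y) * (x - y) *
      (- q * y * ((1 - x * q * y) * (x - q * y) * (1 - q * y)) * s)"
    unfolding IH by (simp only: mult_ac)
  also have "\<dots> = ((1 - x * q\<^sup>2) * (1 - x * q ^ 3 * y) * (x - q\<^sup>2 * y) * s1) * D"
    unfolding s[symmetric] D_def by (simp only: mult_ac)
  finally show ?thesis using nz unfolding D_def by simp
qed

text \<open>What remains of the WZ equation in \<open>sx_telescope\<close> once all terms are
  expressed through \<open>sx M (Suc k)\<close>.\<close>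

lemma wpf_telescope_identity:
  fixes x q y :: "'a::field"
  shows "(1 - q ^ 5 * y\<^sup>2) * ((1 - x * q ^ 3 * y) * (x - q\<^sup>2 * y) + x * (x * q - q\<^sup>2 * y) * (1 - x * q ^ 4 * y))
   = (1 + x * q) * (q\<^sup>2 * y * (1 - x * q ^ 3 * y) * (1 - q ^ 3 * y) * (x * q - q\<^sup>2 * y)
       + (1 - x * q ^ 4 * y) * (x - q\<^sup>2 * y) * (1 - q\<^sup>2 * y))"
  by algebra

context
  fixes q :: "'a::field"
  assumes q0: "q \<noteq> 0" and qne1: "\<And>i. i \<ge> 1 \<Longrightarrow> q ^ i \<noteq> 1"
begin

lemma q_power_inj: "q ^ i = q ^ j \<longleftrightarrow> i = j"
proof -
  have *: "i = j" if "q ^ i = q ^ j" "i \<le> j" for i j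
  proof -
    have "q ^ j = q ^ i * q ^ (j - i)" using that(2) by (simp flip: power_add)
    hence "q ^ (j - i) = 1" using that(1) q0 by simp
    thus ?thesis using qne1[of "j - i"] that(2) by linarith
  qed
  show ?thesis using *[of i j] *[of j i] by (metis nle_le)
qed

lemma one_eq_q_power: "1 = q ^ i \<longleftrightarrow> i = 0"
  using q_power_inj[of 0 i] by auto

lemma q_power_nonzero: "q ^ i \<noteq> 0"
  using q0 by simp

lemmas q_simps = q_power_inj one_eq_q_power q_power_nonzero
  power_add[symmetric] power_Suc[symmetric] power_Suc2[symmetric]

lemma wpf_nonzero: "e \<ge> 1 \<Longrightarrow> e \<noteq> n \<Longrightarrow> wpf (q ^ n) q e \<noteq> 0"
  unfolding wpf_def using q0 qne1[of "n + e"] qne1[of e] q_power_inj[of e n]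
  by (simp add: power_add)

text \<open>The value of \<open>cq k\<close> without its factor [4k+1] at a = q^(2M+1). Denominators
  have even index and do not vanish; the numerator vanishes at \<open>i = M\<close>.\<close>

definition sx :: "nat \<Rightarrow> nat \<Rightarrow> 'a" where
  "sx M k = (\<Prod>i<k. - (q ^ (2 * i + 1)) * wpf (q ^ (2 * M + 1)) q (2 * i + 1)
      / wpf (q ^ (2 * M + 1)) q (2 * i + 2))"

lemma sx_Suc:
  assumes "x = q ^ (2 * M + 1)" "y = q ^ (2 * k)"
  shows "sx M (Suc k) * ((1 - x * q\<^sup>2 * y) * (x - q\<^sup>2 * y) * (1 - q\<^sup>2 * y)) =
      - q * y * ((1 - x * q * y) * (x - q * y) * (1 - q * y)) * sx M k"
proof -
  have nz: "wpf (q ^ (2 * M + 1)) q (2 * k + 2) \<noteq> 0" by (rule wpf_nonzero) presburger+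
  have x0: "x \<noteq> 0" using assms q0 by simp
  have w1: "x * wpf (q ^ (2 * M + 1)) q (2 * k + 1) = (1 - x * q * y) * (x - q * y) * (1 - q * y)"
    and w2: "x * wpf (q ^ (2 * M + 1)) q (2 * k + 2) = (1 - x * q\<^sup>2 * y) * (x - q\<^sup>2 * y) * (1 - q\<^sup>2 * y)"
    unfolding assms(1)[symmetric] wpf_mult[OF x0] by (simp_all add: assms(2) power_add mult_ac power2_eq_square)
  have "sx M (Suc k) * (x * wpf (q ^ (2 * M + 1)) q (2 * k + 2)) =
    - q * y * (x * wpf (q ^ (2 * M + 1)) q (2 * k + 1)) * sx M k"
    unfolding sx_def using nz by (simp add: assms(2))
  thus ?thesis unfolding w1 w2 .
qed

text \<open>Raising \<open>M\<close> by 1 replaces a by a q^2, which shifts the factors by one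
  place; the quotient of the two products telescopes to a rational function of \<open>q\<close>,
  \<open>x\<close> and q^(2k).\<close>

lemma sx_shift:
  assumes "x = q ^ (2 * M + 1)" "k \<le> M"
  shows "(1 - x) * sx (Suc M) k * (x * q - q ^ (2 * k)) * (1 - x * q\<^sup>2 * q ^ (2 * k))
    = (1 - x * q\<^sup>2) * (1 - x * q * q ^ (2 * k)) * (x - q ^ (2 * k)) * sx M k"
  using assms(2)
proof (induction k)
  case 0
  show ?case by (simp add: sx_def) algebra
next
  case (Suc k)
  define y where "y = q ^ (2 * k)"
  have xq2: "x * q\<^sup>2 = q ^ (2 * Suc M + 1)" using assms(1) by (simp add: power2_eq_square)
  have y': "q ^ (2 * Suc k) = q\<^sup>2 * y" by (simp add: y_def power2_eq_square)
  have IH: "(1 - x) * sx (Suc M) k * (x * q - y) * (1 - x * q\<^sup>2 * y)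
    = (1 - x * q\<^sup>2) * (1 - x * q * y) * (x - y) * sx M k"
    unfolding y_def by (rule Suc.IH) (use Suc.prems in simp)
  have nz: "x - y \<noteq> 0" "1 - q\<^sup>2 * y \<noteq> 0" "1 - x * q\<^sup>2 * y \<noteq> 0"
    unfolding assms(1) y_def right_minus_eq
    by (simp_all only: q_simps) presburger
  \<comment> \<open>For \<open>M + 1\<close> the role of \<open>x\<close> is played by x q^2; the
    middle factors are then q^2 (x - y) and q (x q - y), and powers of \<open>q\<close> are
    cancelled.\<close>
  have s': "sx (Suc M) (Suc k) * ((1 - x * q ^ 4 * y) * (x - y) * (1 - q\<^sup>2 * y)) * q =
      - q * y * ((1 - x * q ^ 3 * y) * (x * q - y) * (1 - q * y)) * sx (Suc M) k"
  proof -
    have "q\<^sup>2 * (sx (Suc M) (Suc k) * ((1 - x * q ^ 4 * y) * (x - y) * (1 - q\<^sup>2 * y)) * q) =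
        q\<^sup>2 * (- q * y * ((1 - x * q ^ 3 * y) * (x * q - y) * (1 - q * y)) * sx (Suc M) k)"
      using sx_Suc[OF xq2 y_def] by algebra
    thus ?thesis by (simp only: mult_left_cancel[OF q_power_nonzero])
  qed
  from wpf_shift_identity[OF nz IH sx_Suc[OF assms(1) y_def] s']
  show ?case unfolding y' by (simp add: mult_ac power2_eq_square power_numeral_reduce)
qed

text \<open>
  With \<open>F M k = (1 - q ^ (4 * k + 1)) * sx M k / ((- 1) ^ M * q ^ (M\<^sup>2) * (1 - q ^ (2 * M + 1)))\<close> this is
  the WZ equation \<open>F (M + 1) k - F M k = G (k + 1) - G k\<close> summed over \<open>k\<close>,
  up to a factor independent of \<open>k\<close>; here \<open>G k / sx M k\<close> is rational in \<open>q\<close>, \<open>x\<close> and \<open>q ^ (2 * k)\<close>.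
\<close>

lemma sx_telescope:
  assumes x: "x = q ^ (2 * M + 1)" and "K \<le> M"
  shows "(\<Sum>k\<le>K. (1 - q ^ (4 * k + 1)) * ((1 - x) * sx (Suc M) k + x * (1 - x * q\<^sup>2) * sx M k))
     * (1 - x * q\<^sup>2 * q ^ (2 * K)) =
     (1 - x * q\<^sup>2) * (1 + x * q) * q ^ (2 * K) * (1 - x * q * q ^ (2 * K)) * (1 - q * q ^ (2 * K)) * sx M K"
  using assms(2)
proof (induction K)
  case 0
  show ?case by (simp add: sx_def) algebra
next
  case (Suc k)
  define y where "y = q ^ (2 * k)"
  have y': "q ^ (2 * Suc k) = q\<^sup>2 * y" by (simp add: y_def power2_eq_square)
  have y4: "q ^ (4 * Suc k + 1) = q ^ 5 * y\<^sup>2"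
    unfolding y_def by (simp add: power2_eq_square flip: power_add)
  define S where "S = (\<Sum>k\<le>k. (1 - q ^ (4 * k + 1)) * ((1 - x) * sx (Suc M) k + x * (1 - x * q\<^sup>2) * sx M k))"
  define s1 where "s1 = sx M (Suc k)"
  define s1' where "s1' = sx (Suc M) (Suc k)"
  have IH: "S * (1 - x * q\<^sup>2 * y) = (1 - x * q\<^sup>2) * (1 + x * q) * y * (1 - x * q * y) * (1 - q * y) * sx M k"
    unfolding y_def S_def by (rule Suc.IH) (use Suc.prems in simp)
  \<comment> \<open>The second factor is q^(2M+2) - q^(2k+2), nonzero because
    \<open>Suc k \<le> M\<close>.\<close>
  have nz: "1 - x * q\<^sup>2 * y \<noteq> 0" "x * q - q\<^sup>2 * y \<noteq> 0" "x - q * y \<noteq> 0"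
    unfolding x y_def right_minus_eq using Suc.prems
    by (simp_all only: q_simps)
  have s: "s1 * ((1 - x * q\<^sup>2 * y) * (x - q\<^sup>2 * y) * (1 - q\<^sup>2 * y)) =
      - q * y * ((1 - x * q * y) * (x - q * y) * (1 - q * y)) * sx M k"
    unfolding s1_def by (rule sx_Suc[OF x y_def])
  have sh: "(1 - x) * s1' * (x * q - q\<^sup>2 * y) * (1 - x * q ^ 4 * y)
    = (1 - x * q\<^sup>2) * (1 - x * q ^ 3 * y) * (x - q\<^sup>2 * y) * s1"
    using sx_shift[OF x Suc.prems] unfolding y' s1_def s1'_def
    by (simp add: mult_ac power2_eq_square power_numeral_reduce)
  \<comment> \<open>Induction hypothesis and recurrence express the partial sum through the next
    term \<open>s1\<close>.\<close>
  have Sq: "S * q * (x - q * y) = - (1 - x * q\<^sup>2) * (1 + x * q) * (x - q\<^sup>2 * y) * (1 - q\<^sup>2 * y) * s1"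
  proof -
    have "(1 - x * q\<^sup>2 * y) * (S * q * (x - q * y)) = (1 - x * q\<^sup>2 * y) *
       (- (1 - x * q\<^sup>2) * (1 + x * q) * (x - q\<^sup>2 * y) * (1 - q\<^sup>2 * y) * s1)"
      using IH s by algebra
    thus ?thesis using nz by simp
  qed
  \<comment> \<open>The factor x q - q^2 y lets \<open>sh\<close> replace \<open>s1'\<close> by
    \<open>s1\<close>, so that everything becomes a multiple of \<open>s1\<close>.\<close>
  have "(x * q - q\<^sup>2 * y) * ((S + (1 - q ^ 5 * y\<^sup>2) * ((1 - x) * s1' + x * (1 - x * q\<^sup>2) * s1)) * (1 - x * q ^ 4 * y))
    = (x * q - q\<^sup>2 * y) * ((1 - x * q\<^sup>2) * (1 + x * q) * (q\<^sup>2 * y) * (1 - x * q ^ 3 * y) * (1 - q ^ 3 * y) * s1)"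
    (is "?L = ?R")
  proof -
    have "?L = (S * q * (x - q * y)) * (1 - x * q ^ 4 * y) + (1 - q ^ 5 * y\<^sup>2) *
       (((1 - x) * s1' * (x * q - q\<^sup>2 * y) * (1 - x * q ^ 4 * y))
         + x * (1 - x * q\<^sup>2) * s1 * (x * q - q\<^sup>2 * y) * (1 - x * q ^ 4 * y))"
      by algebra
    also have "\<dots> = (1 - x * q\<^sup>2) * s1 * ((1 - q ^ 5 * y\<^sup>2) * ((1 - x * q ^ 3 * y) * (x - q\<^sup>2 * y) + x * (x * q - q\<^sup>2 * y) * (1 - x * q ^ 4 * y))
        - (1 + x * q) * ((1 - x * q ^ 4 * y) * (x - q\<^sup>2 * y) * (1 - q\<^sup>2 * y)))"
      unfolding Sq sh by algebra
    also have "\<dots> = ?R" unfolding wpf_telescope_identity by algebra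
    finally show ?thesis .
  qed
  hence "(S + (1 - q ^ 5 * y\<^sup>2) * ((1 - x) * s1' + x * (1 - x * q\<^sup>2) * s1)) * (1 - x * q ^ 4 * y)
    = (1 - x * q\<^sup>2) * (1 + x * q) * (q\<^sup>2 * y) * (1 - x * q ^ 3 * y) * (1 - q ^ 3 * y) * s1"
    using nz by simp
  thus ?case unfolding sum.atMost_Suc y4 y' S_def[symmetric] s1_def[symmetric] s1'_def[symmetric]
    by (simp add: mult_ac power2_eq_square power_numeral_reduce)
qed

text \<open>Induction on \<open>M\<close>: \<open>sx_telescope\<close> with \<open>K = M\<close>
  compares the two sums up to index \<open>M\<close>, and its boundary term cancels against the one
  new term, that of index \<open>M + 1\<close>.\<close>

lemma sx_sum: "(\<Sum>k\<le>M. (1 - q ^ (4 * k + 1)) * sx M k) = (- 1) ^ M * q ^ (M\<^sup>2) * (1 - q ^ (2 * M + 1))"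
proof (induction M)
  case 0
  show ?case by (simp add: sx_def)
next
  case (Suc M)
  define x where "x = q ^ (2 * M + 1)"
  define y where "y = q ^ (2 * M)"
  have xy: "x = q * y" by (simp add: x_def y_def)
  have xq2: "x * q\<^sup>2 = q ^ (2 * Suc M + 1)" by (simp add: x_def power2_eq_square)
  define A where "A = (\<Sum>k\<le>M. (1 - q ^ (4 * k + 1)) * sx M k)"
  define A' where "A' = (\<Sum>k\<le>M. (1 - q ^ (4 * k + 1)) * sx (Suc M) k)"
  define s where "s = sx M M"
  define s' where "s' = sx (Suc M) M"
  define s1 where "s1 = sx (Suc M) (Suc M)"
  have y4: "q ^ (4 * Suc M + 1) = q ^ 5 * y\<^sup>2"
    unfolding y_def by (simp add: power2_eq_square flip: power_add)
  have sumeq: "(\<Sum>k\<le>M. (1 - q ^ (4 * k + 1)) * ((1 - x) * sx (Suc M) k + x * (1 - x * q\<^sup>2) * sx M k))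
     = (1 - x) * A' + x * (1 - x * q\<^sup>2) * A"
    unfolding A_def A'_def sum_distrib_left sum.distrib[symmetric]
    by (rule sum.cong) (simp_all add: algebra_simps)
  have T: "((1 - x) * A' + x * (1 - x * q\<^sup>2) * A) * (1 - x * q\<^sup>2 * y) =
     (1 - x * q\<^sup>2) * (1 + x * q) * y * (1 - x * q * y) * (1 - q * y) * s"
    using sx_telescope[OF x_def order_refl] unfolding sumeq y_def s_def .
  have nz: "1 - x \<noteq> 0" "1 - x * q\<^sup>2 * y \<noteq> 0" "1 - q \<noteq> 0" "y \<noteq> 0" "1 - x * q \<noteq> 0"
    unfolding x_def y_def right_minus_eq using qne1[of 1] q0
    by (simp_all add: q_simps del: power_Suc)
  have sh: "(1 - x) * s' * (x * q - y) * (1 - x * q\<^sup>2 * y) = (1 - x * q\<^sup>2) * (1 - x * q * y) * (x - y) * s"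
    using sx_shift[OF x_def order_refl] unfolding y_def s_def s'_def .
  have r: "s1 * ((1 - x * q\<^sup>2 * q\<^sup>2 * y) * (x * q\<^sup>2 - q\<^sup>2 * y) * (1 - q\<^sup>2 * y)) =
      - q * y * ((1 - x * q\<^sup>2 * q * y) * (x * q\<^sup>2 - q * y) * (1 - q * y)) * s'"
    using sx_Suc[OF xq2 y_def] unfolding s1_def s'_def .
  \<comment> \<open>At \<open>k = M\<close> one has x = q y, so \<open>sh\<close> has the common
    factor y (1 - q); in \<open>r'\<close> the factor 1 - x q is cancelled as well.\<close>
  have sh': "(1 - x) * s' * (q + 1) * (1 - x * q\<^sup>2 * y) = (1 - x * q\<^sup>2) * (1 - x\<^sup>2) * s"
  proof -
    have "(y * (1 - q)) * ((1 - x) * s' * (q + 1) * (1 - x * q\<^sup>2 * y)) =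
        (y * (1 - q)) * ((1 - x * q\<^sup>2) * (1 - x\<^sup>2) * s)"
      using sh unfolding xy by algebra
    thus ?thesis using nz by simp
  qed
  have r': "s1 * (1 - q ^ 5 * y\<^sup>2) = - y * (1 + x * q) * (q + 1) * (1 - x) * s'"
  proof -
    have "(q\<^sup>2 * y * (1 - q) * (1 - x * q)) * (s1 * (1 - q ^ 5 * y\<^sup>2)) =
      (q\<^sup>2 * y * (1 - q) * (1 - x * q)) * (- y * (1 + x * q) * (q + 1) * (1 - x) * s')"
      using r unfolding xy by algebra
    moreover have nz': "q\<^sup>2 * y * (1 - q) * (1 - x * q) \<noteq> 0" using nz q0 by simp
    ultimately show ?thesis by (simp only: mult_left_cancel[OF nz'])
  qed
  have "(1 - x * q\<^sup>2 * y) * ((1 - x) * (A' + (1 - q ^ 5 * y\<^sup>2) * s1)) =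
        (1 - x * q\<^sup>2 * y) * (- x * (1 - x * q\<^sup>2) * A)" (is "?L = ?R")
  proof -
    have "?L = ((1 - x) * A' + x * (1 - x * q\<^sup>2) * A) * (1 - x * q\<^sup>2 * y)
        + (1 - x) * (1 - x * q\<^sup>2 * y) * (s1 * (1 - q ^ 5 * y\<^sup>2)) + ?R" by algebra
    also have "\<dots> = (1 - x * q\<^sup>2) * (1 + x * q) * y * (1 - x * q * y) * (1 - q * y) * s
        - y * (1 + x * q) * (1 - x) * ((1 - x) * s' * (q + 1) * (1 - x * q\<^sup>2 * y)) + ?R"
      unfolding T r' by algebra
    also have "\<dots> = ?R" unfolding sh' unfolding xy by algebra
    finally show ?thesis .
  qed
  hence "(1 - x) * (A' + (1 - q ^ 5 * y\<^sup>2) * s1) = - x * (1 - x * q\<^sup>2) * A" by (simp only: mult_left_cancel[OF nz(2)])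
  also have "\<dots> = - x * (1 - x * q\<^sup>2) * ((- 1) ^ M * q ^ (M\<^sup>2) * (1 - x))"
    unfolding A_def Suc.IH x_def ..
  also have "\<dots> = (1 - x) * (- x * (1 - x * q\<^sup>2) * ((- 1) ^ M * q ^ (M\<^sup>2)))"
    by (simp only: mult_ac)
  finally have "A' + (1 - q ^ 5 * y\<^sup>2) * s1 = - x * (1 - x * q\<^sup>2) * ((- 1) ^ M * q ^ (M\<^sup>2))"
    by (simp only: mult_left_cancel[OF nz(1)])
  moreover have "q ^ ((Suc M)\<^sup>2) = x * q ^ (M\<^sup>2)"
  proof -
    have "(Suc M)\<^sup>2 = (2 * M + 1) + M\<^sup>2" by (simp add: power2_eq_square)
    thus ?thesis unfolding x_def by (simp only: power_add)
  qed
  ultimately show ?case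
    unfolding sum.atMost_Suc y4 A'_def[symmetric] s1_def[symmetric] xq2[symmetric] by simp
qed

end

text \<open>The recurrence has no vanishing denominator and so determines \<open>s\<close>. It
  passes through the index 2M+1, where \<open>wpf\<close> is 0, which kills all later terms.\<close>

lemma wpf_sum:
  fixes q :: "'a::field"
  assumes q0: "q \<noteq> 0" and qne1: "\<And>i. i \<ge> 1 \<Longrightarrow> q ^ i \<noteq> 1"
    and s0: "s 0 = 1"
    and rec: "\<And>k. s (Suc k) * wpf (q ^ (2 * M + 1)) q (2 * k + 2) =
      - (q ^ (2 * k + 1)) * wpf (q ^ (2 * M + 1)) q (2 * k + 1) * s k"
  shows "(\<Sum>k\<le>M. (1 - q ^ (4 * k + 1)) * s k) = (- 1) ^ M * q ^ (M\<^sup>2) * (1 - q ^ (2 * M + 1))"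
    and "k > M \<Longrightarrow> s k = 0"
proof -
  have nz: "wpf (q ^ (2 * M + 1)) q (2 * k + 2) \<noteq> 0" for k
    by (rule wpf_nonzero[OF q0 qne1]) presburger+
  have "s k = sx q M k" for k
  proof (induction k)
    case 0
    show ?case by (simp add: s0 sx_def[OF q0 qne1])
  next
    case (Suc k)
    have "s (Suc k) = - (q ^ (2 * k + 1)) * wpf (q ^ (2 * M + 1)) q (2 * k + 1) * s k
        / wpf (q ^ (2 * M + 1)) q (2 * k + 2)"
      by (simp only: nonzero_eq_divide_eq[OF nz] rec)
    thus ?case by (simp add: Suc.IH sx_def[OF q0 qne1])
  qed
  thus "(\<Sum>k\<le>M. (1 - q ^ (4 * k + 1)) * s k) = (- 1) ^ M * q ^ (M\<^sup>2) * (1 - q ^ (2 * M + 1))"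
    using sx_sum[OF q0 qne1, of M] by simp
  show "s k = 0" if "k > M"
    using that
  proof (induction k rule: less_induct)
    case (less k)
    then obtain j where j: "k = Suc j" by (cases k) auto
    have "s k * wpf (q ^ (2 * M + 1)) q (2 * j + 2) = 0"
    proof (cases "j = M")
      case True
      have "wpf (q ^ (2 * M + 1)) q (2 * M + 1) = 0" using q0 by (simp add: wpf_def)
      thus ?thesis unfolding j rec True by simp
    next
      case False
      hence "s j = 0" using less j by simp
      thus ?thesis unfolding j rec by simp
    qed
    thus ?case using nz[of j] by simp
  qed
qed

lemma qint_mult: "(1 - q) * qint q m = 1 - (q :: 'a::comm_ring_1) ^ m"
  unfolding qint_def by (rule one_diff_power_eq[symmetric])

section \<open>The recurrence at roots of unity\<close>

lemma antisym_sum_eq_0: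
  fixes w :: "nat \<Rightarrow> 'a::field_char_0"
  assumes "\<And>r. r \<le> N \<Longrightarrow> w (N - r) = - w r"
  shows "(\<Sum>r\<le>N. w r) = 0"
proof -
  have "(\<Sum>r\<le>N. w r) = (\<Sum>r\<le>N. w (N - r))"
    using sum.nat_diff_reindex[of w "Suc N"] by (simp add: lessThan_Suc_atMost)
  also have "\<dots> = - (\<Sum>r\<le>N. w r)" unfolding sum_negf[symmetric] by (rule sum.cong) (use assms in auto)
  finally show ?thesis by simp
qed

text \<open>Through the factor \<open>1 - z ^ e\<close> the last assumption makes \<open>z\<close> a
  primitive \<open>d\<close>-th root of unity; the other two factors keep \<open>a\<close> off the
  powers of \<open>z\<close> other than 1.\<close>

locale wpf_root_of_unity =
  fixes a z :: "'a::field_char_0" and d M :: nat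
  assumes d: "d = 2 * M + 1" and M: "M \<ge> 1" and zd: "z ^ d = 1" and z1: "z \<noteq> 1" and a0: "a \<noteq> 0"
    and wpf_nz: "\<And>e. \<not> d dvd e \<Longrightarrow> wpf a z e \<noteq> 0"
begin

lemma z0: "z \<noteq> 0"
  using zd d by auto

lemma z_power_mult: "z ^ (l * d) = 1"
  by (simp add: power_mult zd mult.commute[of l])

lemma wpf_add_mult: "wpf a z (l * d + e) = wpf a z e"
  by (simp add: wpf_def power_add z_power_mult)

text \<open>In the form cleared by \<open>a\<close>, multiplying a factor for \<open>e\<close> by
  z^e', the inverse of z^e, gives minus a factor for \<open>e'\<close>; the three signs leave
  one.\<close>

lemma wpf_reflect:
  assumes "e + e' = d"
  shows "wpf a z e * (z ^ e') ^ 3 = - wpf a z e'"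
proof -
  have 1: "z ^ e * z ^ e' = 1" using zd assms by (simp flip: power_add)
  have "(a * wpf a z e) * (z ^ e') ^ 3 = - (a * wpf a z e')"
  proof -
    have "((1 - a * X) * (a - X) * (1 - X)) * Y ^ 3 = - ((1 - a * Y) * (a - Y) * (1 - Y))"
      if "X * Y = 1" for X Y :: 'a
    proof -
      have "((1 - a * X) * (a - X) * (1 - X)) * Y ^ 3 =
        (Y - a * (X * Y)) * (a * Y - X * Y) * (Y - X * Y)" by algebra
      thus ?thesis unfolding that by algebra
    qed
    thus ?thesis unfolding wpf_mult[OF a0] using 1 by blast
  qed
  hence "a * (wpf a z e * (z ^ e') ^ 3) = a * (- wpf a z e')" by (simp only: mult.assoc mult_minus_right)
  thus ?thesis by (simp only: mult_left_cancel[OF a0])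
qed

lemma wpf_d: "wpf a z d = 0"
  by (simp add: wpf_def zd)

text \<open>
  The case \<open>t = 0\<close> concerns the terms \<open>0 \<le> k \<le> M\<close>. The case \<open>t = 1\<close> concerns the terms \<open>M < k < d\<close>, with
  \<open>i = k - M - 1\<close>; they vanish at \<open>z\<close>, but their quotients by \<open>\<Phi>\<^sub>d\<close> satisfy the same recurrence.
\<close>

lemma recurrence_reflect:
  assumes Nt: "2 * N + 1 + 2 * t = d"
    and rec: "\<And>i. i < N \<Longrightarrow> u (Suc i) * wpf a z (2 * i + 2 + t) =
      - (z ^ (2 * i + 1 + t)) * wpf a z (2 * i + 1 + t) * u i"
    and "r \<le> N"
  shows "u (N - r) = z ^ (4 * r + 1 + 2 * t) * u r"
  using \<open>r \<le> N\<close>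
proof (induction r)
  case 0
  define h where "h = (\<lambda>i. wpf a z (2 * i + 2 + t))"
  \<comment> \<open>Base case: the recurrence is multiplied out from 0 to \<open>N\<close>. By
    \<open>wpf_reflect\<close> the numerators are the denominators in reverse order, up to powers of
    \<open>z\<close>.\<close>
  have "u k * (\<Prod>i<k. h i) = (\<Prod>i<k. - (z ^ (2 * i + 1 + t)) * wpf a z (2 * i + 1 + t)) * u 0"
    if "k \<le> N" for k
    using that
  proof (induction k)
    case (Suc k)
    have "u (Suc k) * (\<Prod>i<Suc k. h i) = (u (Suc k) * h k) * (\<Prod>i<k. h i)"
      by (simp add: mult_ac)
    also have "u (Suc k) * h k = - (z ^ (2 * k + 1 + t)) * wpf a z (2 * k + 1 + t) * u k"
      unfolding h_def by (rule rec) (use Suc.prems in simp)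
    finally show ?case using Suc by (simp add: mult_ac)
  qed simp
  hence "u N * (\<Prod>i<N. h i) = (\<Prod>i<N. - (z ^ (2 * i + 1 + t)) * wpf a z (2 * i + 1 + t)) * u 0"
    by simp
  also have "(\<Prod>i<N. - (z ^ (2 * i + 1 + t)) * wpf a z (2 * i + 1 + t)) =
     (\<Prod>i<N. z ^ (4 * (2 * i + 1 + t)) * h (N - Suc i))"
  proof (rule prod.cong)
    fix i assume "i \<in> {..<N}"
    hence "h (N - Suc i) * (z ^ (2 * i + 1 + t)) ^ 3 = - wpf a z (2 * i + 1 + t)"
      unfolding h_def by (intro wpf_reflect) (use Nt in auto)
    moreover have "z ^ (4 * (2 * i + 1 + t)) = (z ^ (2 * i + 1 + t)) ^ 4"
      by (simp only: power_mult[symmetric] mult.commute)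
    moreover have "Q ^ 4 * h' = - Q * g" if "h' * Q ^ 3 = - g" for Q h' g :: 'a
      using that by algebra
    ultimately show "- (z ^ (2 * i + 1 + t)) * wpf a z (2 * i + 1 + t) =
       z ^ (4 * (2 * i + 1 + t)) * h (N - Suc i)" by metis
  qed simp
  also have "\<dots> = (\<Prod>i<N. z ^ (4 * (2 * i + 1 + t))) * (\<Prod>i<N. h i)"
    by (simp add: prod.distrib prod.nat_diff_reindex)
  also have "(\<Prod>i<N. z ^ (4 * (2 * i + 1 + t))) = z ^ (4 * N * N + 4 * t * N)"
    by (induction N) (simp_all add: algebra_simps flip: power_add)
  finally have eq: "u N * (\<Prod>i<N. h i) = z ^ (4 * N * N + 4 * t * N) * u 0 * (\<Prod>i<N. h i)"
    by (simp add: mult_ac)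
  have "h i \<noteq> 0" if "i < N" for i
    unfolding h_def by (rule wpf_nz) (use that Nt in \<open>auto dest!: dvd_imp_le\<close>)
  hence "(\<Prod>i<N. h i) \<noteq> 0" by simp
  hence uN: "u N = z ^ (4 * N * N + 4 * t * N) * u 0" using eq by simp
  \<comment> \<open>The exponent equals (2N - 1) d + 1 + 2t; splitting off \<open>N = 0\<close>,
    where 1 + 2t = d, keeps 2N - 1 a natural number.\<close>
  show ?case
  proof (cases N)
    case 0
    hence "z ^ (1 + 2 * t) = 1" using Nt zd by simp
    thus ?thesis using 0 by simp
  next
    case (Suc p)
    have "4 * N * N + 4 * t * N = (2 * p + 1) * d + (1 + 2 * t)"
      unfolding Nt[symmetric] Suc by (simp add: algebra_simps)
    hence "z ^ (4 * N * N + 4 * t * N) = z ^ (1 + 2 * t)"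
      by (simp only: power_add z_power_mult mult_1_left)
    thus ?thesis using uN by simp
  qed
next
  case (Suc r)
  \<comment> \<open>The index \<open>m\<close> mirrors \<open>Suc r\<close>: one recurrence step
    down to \<open>m\<close> is compared with one step up from \<open>r\<close>, and
    \<open>wpf_reflect\<close> matches their factors crosswise.\<close>
  define m where "m = N - Suc r"
  have m: "N - r = Suc m" "m < N" "r < N" "m + r + 1 = N" using Suc.prems by (auto simp: m_def)
  define P Q where "P = z ^ (2 * m + 1 + t)" and "Q = z ^ (2 * r + 1 + t)"
  define hm hr gm gr where "hm = wpf a z (2 * m + 2 + t)" and "hr = wpf a z (2 * r + 2 + t)"
    and "gm = wpf a z (2 * m + 1 + t)" and "gr = wpf a z (2 * r + 1 + t)"
  have "P * Q * z = z ^ d" unfolding P_def Q_def Nt[symmetric] m(4)[symmetric]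
    by (simp only: power_add[symmetric] power_Suc2[symmetric]) (simp add: algebra_simps del: power_Suc)
  hence PQ: "P * Q * z = 1" using zd by simp
  have U: "z * u (Suc m) = Q ^ 2 * u r"
  proof -
    have "z * z ^ (4 * r + 1 + 2 * t) = Q\<^sup>2"
      unfolding Q_def by (simp add: algebra_simps flip: power_mult power_Suc)
    thus ?thesis using Suc by (simp only: m(1)[symmetric] mult.assoc[symmetric])
  qed
  have 1: "u (Suc m) * hm = - P * gm * u m" and 2: "u (Suc r) * hr = - Q * gr * u r"
    using rec[of m] rec[of r] m by (simp_all add: hm_def hr_def gm_def gr_def P_def Q_def)
  have 3: "hm * Q ^ 3 = - gr" and 4: "hr * P ^ 3 = - gm"
    unfolding hm_def hr_def gm_def gr_def P_def Q_def by (intro wpf_reflect; use Nt m in simp)+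
  have "hr * u m = hr * u m * (P * Q * z) ^ 4" using PQ by simp
  also have "\<dots> = (hr * P ^ 3) * (P * u m) * Q ^ 4 * z ^ 4" by algebra
  also have "\<dots> = (u (Suc m) * hm) * Q ^ 4 * z ^ 4" unfolding 1 4 by simp
  also have "\<dots> = (z * u (Suc m)) * (hm * Q ^ 3) * Q * z ^ 3" by algebra
  also have "\<dots> = (- Q * gr * u r) * Q\<^sup>2 * z ^ 3" unfolding U 3 by algebra
  also have "\<dots> = hr * (Q\<^sup>2 * z ^ 3 * u (Suc r))" unfolding 2[symmetric] by algebra
  finally have "hr * u m = hr * (Q\<^sup>2 * z ^ 3 * u (Suc r))" .
  moreover have hr0: "hr \<noteq> 0"
    unfolding hr_def by (rule wpf_nz) (use m Nt in \<open>auto dest!: dvd_imp_le\<close>)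
  ultimately have "u m = Q\<^sup>2 * z ^ 3 * u (Suc r)" by (simp only: mult_left_cancel[OF hr0])
  moreover have "Q\<^sup>2 * z ^ 3 = z ^ (4 * Suc r + 1 + 2 * t)"
    unfolding Q_def by (simp only: power_mult[symmetric] power_add[symmetric]) (simp add: algebra_simps)
  ultimately show ?case unfolding m_def by simp
qed

text \<open>The exponents at mirrored indices add up to 2d, so the two powers of \<open>z\<close>
  are inverse; with them as weights the reflection becomes a change of sign.\<close>

lemma recurrence_antisym:
  assumes Nt: "2 * N + 1 + 2 * t = d"
    and rec: "\<And>i. i < N \<Longrightarrow> u (Suc i) * wpf a z (2 * i + 2 + t) =
      - (z ^ (2 * i + 1 + t)) * wpf a z (2 * i + 1 + t) * u i"
    and r: "r \<le> N"
  shows "(1 - z ^ (4 * (N - r) + 1 + 2 * t)) * u (N - r) = - ((1 - z ^ (4 * r + 1 + 2 * t)) * u r)"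
proof -
  have "4 * (N - r) + 1 + 2 * t + (4 * r + 1 + 2 * t) = 2 * d" using r unfolding Nt[symmetric] by simp
  hence "z ^ (4 * (N - r) + 1 + 2 * t) * z ^ (4 * r + 1 + 2 * t) = 1"
    unfolding power_add[symmetric] by (simp only: z_power_mult)
  moreover have "(1 - X) * (Y * v) = - ((1 - Y) * v)" if "X * Y = 1" for X Y v :: 'a
    using that by algebra
  moreover have "u (N - r) = z ^ (4 * r + 1 + 2 * t) * u r"
    by (rule recurrence_reflect[OF Nt _ r]) (rule rec)
  ultimately show ?thesis by metis
qed

end

text \<open>Here \<open>s k\<close> models the value of \<open>cq k\<close> without [4k+1]. The
  recurrence is free of division because \<open>wpf\<close> vanishes when \<open>d\<close> divides
  2k+2; there \<open>s (Suc k)\<close> is left undetermined.\<close>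

locale wpf_sequence = wpf_root_of_unity a z d M for a z :: "'a::field_char_0" and d M +
  fixes s :: "nat \<Rightarrow> 'a"
  assumes s0: "s 0 = 1"
    and rec: "\<And>k. s (Suc k) * wpf a z (2 * k + 2) = - (z ^ (2 * k + 1)) * wpf a z (2 * k + 1) * s k"
begin

definition c where "c k = qint z (4 * k + 1) * s k"

definition T where "T x = (\<Sum>i<x. c i)"

lemma c_mult: "(1 - z) * c k = (1 - z ^ (4 * k + 1)) * s k"
  unfolding c_def by (simp only: mult.assoc[symmetric] qint_mult)

lemma wpf_even_nz: "Suc r < d \<Longrightarrow> wpf a z (2 * r + 2) \<noteq> 0"
proof (rule wpf_nz, rule notI)
  assume r: "Suc r < d" and "d dvd 2 * r + 2"
  hence "d dvd 2 * Suc r" by simp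
  moreover have "coprime d 2" using d by simp
  ultimately have "d dvd Suc r" using coprime_dvd_mult_right_iff by blast
  thus False using r by (auto dest: dvd_imp_le)
qed

text \<open>The coefficients of the recurrence are periodic modulo \<open>d\<close>, so each block
  is the first one scaled by its initial value.\<close>

lemma s_block: "r < d \<Longrightarrow> s (l * d + r) = s (l * d) * s r"
proof (induction r)
  case (Suc r)
  have w: "wpf a z (2 * (l * d + r) + e) = wpf a z (2 * r + e)" for e
    using wpf_add_mult[of "2 * l" "2 * r + e"] by (simp add: algebra_simps)
  have p: "z ^ (2 * (l * d + r) + 1) = z ^ (2 * r + 1)"
  proof -
    have "z ^ (2 * (l * d + r) + 1) = z ^ ((2 * l) * d) * z ^ (2 * r + 1)"
      by (simp only: power_add[symmetric]) (simp add: algebra_simps)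
    thus ?thesis by (simp only: z_power_mult mult_1_left)
  qed
  have "s (l * d + Suc r) * wpf a z (2 * r + 2) = s (l * d) * s (Suc r) * wpf a z (2 * r + 2)"
  proof -
    have "s (l * d + Suc r) * wpf a z (2 * r + 2) =
        - (z ^ (2 * r + 1)) * wpf a z (2 * r + 1) * (s (l * d) * s r)"
      using rec[of "l * d + r"] Suc unfolding w p by simp
    also have "\<dots> = s (l * d) * (s (Suc r) * wpf a z (2 * r + 2))" unfolding rec by simp
    finally show ?thesis by (simp only: mult.assoc)
  qed
  thus ?case using wpf_even_nz[OF Suc.prems] by simp
qed (simp add: s0)

lemma c_block: "r < d \<Longrightarrow> c (l * d + r) = s (l * d) * c r"
proof -
  assume r: "r < d"
  have "z ^ (4 * (l * d + r) + 1) = z ^ ((4 * l) * d) * z ^ (4 * r + 1)"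
    by (simp only: power_add[symmetric]) (simp add: algebra_simps)
  hence "z ^ (4 * (l * d + r) + 1) = z ^ (4 * r + 1)" by (simp only: z_power_mult mult_1_left)
  hence "(1 - z) * c (l * d + r) = (1 - z) * (s (l * d) * c r)"
    unfolding mult.left_commute[of "1 - z"] c_mult s_block[OF r] by simp
  thus ?thesis using z1 by simp
qed

text \<open>The step from \<open>M\<close> to \<open>M + 1\<close> has numerator \<open>wpf\<close>
  at 2M+1 = d, which is 0; up to \<open>d\<close> the denominators are nonzero.\<close>

lemma s_eq_0: "M < r \<Longrightarrow> r < d \<Longrightarrow> s r = 0"
proof (induction r)
  case (Suc r)
  have "s (Suc r) * wpf a z (2 * r + 2) = 0"
  proof (cases "r = M")
    case True
    thus ?thesis unfolding rec using wpf_d d by simp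
  next
    case False
    thus ?thesis unfolding rec using Suc by simp
  qed
  thus ?case using wpf_even_nz Suc.prems by simp
qed simp

lemma c_antisym: "r \<le> M \<Longrightarrow> c (M - r) = - c r"
proof -
  assume r: "r \<le> M"
  have "(1 - z) * c (M - r) = (1 - z) * (- c r)"
    using recurrence_antisym[of M 0 s r] d rec r unfolding mult_minus_right c_mult by simp
  moreover have "1 - z \<noteq> 0" using z1 by simp
  ultimately show ?thesis by (metis mult_left_cancel)
qed

lemma T_eq_0_first: "M < x \<Longrightarrow> x \<le> d \<Longrightarrow> T x = 0"
proof -
  assume x: "M < x" "x \<le> d"
  have "T x = (\<Sum>i\<le>M. c i)" unfolding T_def
    by (rule sum.mono_neutral_right) (use x s_eq_0 in \<open>auto simp: c_def\<close>)
  thus ?thesis using antisym_sum_eq_0[of M c] c_antisym by simp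
qed

lemma T_add: "T (l * d + x) = T (l * d) + s (l * d) * T x" if "x \<le> d"
proof -
  have "T (l * d + x) = T (l * d) + (\<Sum>i<x. c (l * d + i))"
    unfolding T_def by (induction x) simp_all
  also have "(\<Sum>i<x. c (l * d + i)) = s (l * d) * T x"
    unfolding T_def sum_distrib_left by (rule sum.cong) (use that c_block in auto)
  finally show ?thesis .
qed

lemma T_mult: "T (l * d) = 0"
proof (induction l)
  case (Suc l)
  have "T (Suc l * d) = T (l * d + d)" by (simp add: add.commute)
  thus ?case using T_add[of d l] Suc T_eq_0_first[of d] d by simp
qed (simp add: T_def)

lemma convolution_eq_0: "(\<Sum>j<m * d. c j * T (m * d - j)) = 0"
proof (rule sum.neutral, rule ballI)
  fix j assume "j \<in> {..<m * d}"
  hence j: "j < m * d" by simp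
  have d0: "d > 0" using d by simp
  define l r where "l = j div d" and "r = j mod d"
  have jlr: "j = l * d + r" and r: "r < d" using d0 by (simp_all add: l_def r_def)
  have l: "l < m" using j d0 unfolding l_def by (simp add: less_mult_imp_div_less)
  show "c j * T (m * d - j) = 0"
  proof (cases "M < r")
    case True
    hence "c j = 0" unfolding jlr c_block[OF r] using s_eq_0 r by (simp add: c_def)
    thus ?thesis by simp
  next
    case False
    obtain p where p: "m = l + Suc p" using l less_imp_Suc_add by auto
    have "m * d - j = p * d + (d - r)" unfolding jlr p using r by (simp add: algebra_simps)
    \<comment> \<open>Whole blocks add nothing to \<open>T\<close>, and \<open>r \<le> M\<close>
      gives M < d - r, so the partial block adds nothing either.\<close>
    hence "T (m * d - j) = 0"
      using T_add[of "d - r" p] T_mult T_eq_0_first[of "d - r"] False d by simp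
    thus ?thesis by simp
  qed
qed

text \<open>As \<open>T (Suc M)\<close> is 0, \<open>T (Suc i)\<close> is minus the sum of the last
  M - i terms up to index \<open>M\<close>; by antisymmetry this is the sum of the first M - i
  terms.\<close>

lemma T_sym: "i < M \<Longrightarrow> T (M - i) = T (Suc i)"
proof -
  assume i: "i < M"
  have *: "T (x + y) = T x + (\<Sum>j<y. c (x + j))" for x y
    unfolding T_def by (induction y) simp_all
  have "0 = T (Suc i + (M - i))" using T_eq_0_first[of "Suc M"] d M i by simp
  also have "\<dots> = T (Suc i) + (\<Sum>j<M - i. c (Suc i + j))" by (rule *)
  also have "(\<Sum>j<M - i. c (Suc i + j)) = (\<Sum>j<M - i. c (Suc i + (M - i - Suc j)))"
    by (rule sum.nat_diff_reindex[symmetric])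
  also have "\<dots> = (\<Sum>j<M - i. - c j)"
  proof (rule sum.cong)
    fix j assume "j \<in> {..<M - i}"
    hence "Suc i + (M - i - Suc j) = M - j" "j \<le> M" using i by auto
    thus "c (Suc i + (M - i - Suc j)) = - c j" using c_antisym by (simp only:)
  qed simp
  also have "\<dots> = - T (M - i)" unfolding T_def by (rule sum_negf)
  finally show ?thesis by simp
qed

text \<open>Meant for \<open>e\<close> the values of \<open>cq\<close> without [4k+1] divided by
  Phi_d. With j = M + 1 + i the weights are antisymmetric under i -> M - 1 - i, while
  \<open>T_sym\<close> makes the factor \<open>T\<close> symmetric.\<close>

lemma derived_convolution_eq_0:
  assumes e: "\<And>k. M < k \<Longrightarrow> Suc k < d \<Longrightarrow>
    e (Suc k) * wpf a z (2 * k + 2) = - (z ^ (2 * k + 1)) * wpf a z (2 * k + 1) * e k"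
  shows "(\<Sum>j\<in>{M<..<d}. qint z (4 * j + 1) * e j * T (d - j)) = 0"
proof -
  define u where "u i = e (Suc M + i)" for i
  define N where "N = M - 1"
  have N: "M = Suc N" using M by (simp add: N_def)
  define w where "w i = (1 - z ^ (4 * i + 1 + 2 * 1)) * u i" for i
  have rec_u: "u (Suc i) * wpf a z (2 * i + 2 + 1) =
      - (z ^ (2 * i + 1 + 1)) * wpf a z (2 * i + 1 + 1) * u i" if "i < N" for i
  proof -
    \<comment> \<open>Shifting the index by M + 1 moves the exponents by d + 1, which is the case
      \<open>t = 1\<close> of the recurrence.\<close>
    have 1: "2 * (Suc M + i) + 1 = 1 * d + (2 * i + 1 + 1)" "2 * (Suc M + i) + 2 = 1 * d + (2 * i + 2 + 1)"
      using d by simp_all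
    have "e (Suc (Suc M + i)) * wpf a z (2 * (Suc M + i) + 2) =
      - (z ^ (2 * (Suc M + i) + 1)) * wpf a z (2 * (Suc M + i) + 1) * e (Suc M + i)"
      by (rule e) (use that N d in auto)
    thus ?thesis unfolding 1 wpf_add_mult u_def by (simp add: power_add zd)
  qed
  have w: "w (N - r) = - w r" if "r \<le> N" for r
    unfolding w_def by (rule recurrence_antisym) (use d N rec_u that in auto)
  have "(1 - z) * (\<Sum>j\<in>{M<..<d}. qint z (4 * j + 1) * e j * T (d - j)) =
     (\<Sum>j\<in>{M<..<d}. ((1 - z) * qint z (4 * j + 1)) * e j * T (d - j))"
    unfolding sum_distrib_left by (simp only: mult.assoc)
  also have "\<dots> = (\<Sum>i\<le>N. w i * T (Suc i))"
    unfolding qint_mult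
  proof (rule sum.reindex_bij_witness[of _ "\<lambda>i. Suc M + i" "\<lambda>j. j - Suc M"])
    fix j assume "j \<in> {M<..<d}"
    hence j: "M < j" "j < d" by auto
    define i where "i = j - Suc M"
    have i: "j = Suc M + i" "i < M" using j d by (auto simp: i_def)
    have "4 * j + 1 = 2 * d + (4 * i + 1 + 2 * 1)" using d i by simp
    hence "z ^ (4 * j + 1) = z ^ (4 * i + 1 + 2 * 1)" by (simp only: power_add z_power_mult mult_1_left)
    moreover have "d - j = M - i" using d i by simp
    ultimately show "w (j - Suc M) * T (Suc (j - Suc M)) = (1 - z ^ (4 * j + 1)) * e j * T (d - j)"
      unfolding i_def[symmetric] w_def u_def i(1)[symmetric] using T_sym[OF i(2)] by (simp only:)
  qed (use N d in auto)
  also have "\<dots> = 0"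
  proof (rule antisym_sum_eq_0)
    fix r assume r: "r \<le> N"
    have "T (Suc (N - r)) = T (Suc r)" using T_sym[of r] N r by (simp add: Suc_diff_le)
    thus "w (N - r) * T (Suc (N - r)) = - (w r * T (Suc r))" using w[OF r] by simp
  qed
  finally show ?thesis using z1 by simp
qed

end

section \<open>The rational functions \<open>cq\<close>\<close>

text \<open>The part of \<open>cq k\<close> that satisfies the first-order recurrence with
  \<open>wpf\<close>; the q-integer is split off.\<close>

definition wp :: "'a::field \<Rightarrow> 'a \<Rightarrow> nat \<Rightarrow> 'a" where
  "wp a q k = (- 1) ^ k * q ^ (k\<^sup>2) * (qpoch [a * q, q / a, q] (q\<^sup>2) k /
     qpoch [a * q\<^sup>2, q\<^sup>2 / a, q\<^sup>2] (q\<^sup>2) k)"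

lemma cq_eq: "cq k = qint qR (4 * k + 1) * wp aR qR k"
  unfolding cq_def wp_def by (simp only: mult_ac)

lemma qpoch_wpf:
  "qpoch [a * q, q / a, q] (q\<^sup>2) k = (\<Prod>i<k. wpf a q (2 * i + 1))"
  "qpoch [a * q\<^sup>2, q\<^sup>2 / a, q\<^sup>2] (q\<^sup>2) k = (\<Prod>i<k. wpf a q (2 * i + 2))"
  unfolding qpoch_def wpf_def prod.distrib
  by (simp_all add: power_add power_mult mult_ac power2_eq_square power_mult_distrib)

lemma wp_0: "wp a q 0 = 1"
  by (simp add: wp_def qpoch_def)

lemma wp_Suc:
  assumes "wpf a q (2 * k + 2) \<noteq> 0"
  shows "wp a q (Suc k) * wpf a q (2 * k + 2) = - (q ^ (2 * k + 1)) * wpf a q (2 * k + 1) * wp a q k"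
proof -
  have "(Suc k)\<^sup>2 = (2 * k + 1) + k\<^sup>2" by (simp add: power2_eq_square)
  hence "q ^ ((Suc k)\<^sup>2) = q ^ (2 * k + 1) * q ^ (k\<^sup>2)" by (simp only: power_add)
  thus ?thesis using assms unfolding wp_def qpoch_wpf by (simp add: mult_ac)
qed

text \<open>The q-binomial coefficients are polynomials, by the q-Pascal rule.\<close>

lemma q_factorial_dvd:
  fixes q :: "'a::comm_ring_1"
  shows "(\<Prod>i<k. 1 - q ^ (i + 1)) dvd (\<Prod>i<k. 1 - q ^ (m + i + 1))"
proof (induction "m + k" arbitrary: m k rule: less_induct)
  case less
  show ?case
  proof (cases k)
    case (Suc j)
    show ?thesis
    proof (cases m)
      case (Suc p)
      have "(\<Prod>i<j. 1 - q ^ (m + i + 1)) * (1 - q ^ (j + 1)) + q ^ (j + 1) * (\<Prod>i<Suc j. 1 - q ^ (p + i + 1))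
        = (\<Prod>i<Suc j. 1 - q ^ (m + i + 1))"
      proof -
        define R where "R = (\<Prod>i<j. 1 - q ^ (m + i + 1))"
        have 1: "(\<Prod>i<Suc j. 1 - q ^ (p + i + 1)) = (1 - q ^ m) * R"
          unfolding prod.lessThan_Suc_shift R_def by (simp add: Suc)
        have 2: "(\<Prod>i<Suc j. 1 - q ^ (m + i + 1)) = R * (1 - q ^ (j + 1) * q ^ m)"
          unfolding R_def by (simp add: power_add mult_ac)
        show ?thesis unfolding 1 2 R_def[symmetric] by (simp only: algebra_simps mult_1_left)
      qed
      moreover have "(\<Prod>i<j. 1 - q ^ (i + 1)) dvd (\<Prod>i<j. 1 - q ^ (m + i + 1))"
        by (rule less) (simp add: \<open>k = Suc j\<close>)
      hence "(\<Prod>i<Suc j. 1 - q ^ (i + 1)) dvd (\<Prod>i<j. 1 - q ^ (m + i + 1)) * (1 - q ^ (j + 1))"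
        by (simp add: mult_dvd_mono)
      moreover have "(\<Prod>i<Suc j. 1 - q ^ (i + 1)) dvd (\<Prod>i<Suc j. 1 - q ^ (p + i + 1))"
        by (rule less) (simp add: Suc \<open>k = Suc j\<close>)
      ultimately show ?thesis unfolding \<open>k = Suc j\<close> by (metis dvd_add dvd_mult)
    qed simp
  qed simp
qed

text \<open>Multiplied by (q;q)_k both sides become (q;q)_(2k), since 1 - q^(2i) = (1 - q^i)(1 +
  q^i). The induction cancels only 1 - q^(k+1).\<close>

lemma q_factorial_split:
  fixes q :: "'a::idom"
  assumes "\<And>i. i \<ge> 1 \<Longrightarrow> q ^ i \<noteq> 1"
  shows "(\<Prod>i<k. 1 - q ^ (2 * i + 1)) * (\<Prod>i<k. 1 + q ^ (i + 1)) = (\<Prod>i<k. 1 - q ^ (k + i + 1))"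
proof (induction k)
  case (Suc k)
  have "(1 - q ^ (k + 1)) * (\<Prod>i<Suc k. 1 - q ^ (Suc k + i + 1)) = (\<Prod>i<Suc (Suc k). 1 - q ^ (k + i + 1))"
    by (subst (2) prod.lessThan_Suc_shift) simp
  also have "\<dots> = (\<Prod>i<k. 1 - q ^ (k + i + 1)) * (1 - q ^ (2 * k + 1)) * (1 - q ^ (2 * k + 2))"
    by (simp add: mult_2)
  also have "\<dots> = (1 - q ^ (k + 1)) * ((\<Prod>i<Suc k. 1 - q ^ (2 * i + 1)) * (\<Prod>i<Suc k. 1 + q ^ (i + 1)))"
  proof -
    have "1 - q ^ (2 * k + 2) = (1 - q ^ (k + 1)) * (1 + q ^ (k + 1))"
      by (simp add: algebra_simps flip: power_add mult_2)
    thus ?thesis unfolding Suc.IH[symmetric] by (simp only: prod.lessThan_Suc mult_ac)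
  qed
  finally show ?case using assms[of "k + 1"] by simp
qed simp

lemma two_power_ne:
  assumes "i \<ge> 1"
  shows "(2 :: complex) ^ i \<noteq> 1" "(2 :: complex) ^ i \<noteq> - 1"
proof -
  have "cmod (2 ^ i) > 1" using assms by (simp add: norm_power one_less_power)
  thus "(2 :: complex) ^ i \<noteq> 1" "(2 :: complex) ^ i \<noteq> - 1" by auto
qed

text \<open>Used to separate rational functions by one sample point with q = 2.\<close>

lemma has_val_ne:
  "has_val z w x v \<Longrightarrow> has_val z w x' v' \<Longrightarrow> v \<noteq> v' \<Longrightarrow> x \<noteq> x'"
  using has_val_unique by blast

lemma qR_power_ne:
  assumes "i \<ge> 1"
  shows "qR ^ i \<noteq> 1" "qR ^ i \<noteq> - 1"
proof -
  have "has_val 2 2 (qR ^ i) (2 ^ i)" by (intro has_val_intros)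
  moreover have "has_val 2 2 (- 1) (- 1)" by (intro has_val_intros)
  ultimately show "qR ^ i \<noteq> 1" "qR ^ i \<noteq> - 1"
    using has_val_ne has_val_1 two_power_ne[OF assms] by blast+
qed

lemma has_val_wpf: "w \<noteq> 0 \<Longrightarrow> has_val z w (wpf aR qR e) (wpf w z e)"
  unfolding wpf_def by (intro has_val_intros)

lemma wpf_R_nonzero: "e \<ge> 1 \<Longrightarrow> wpf aR qR e \<noteq> 0"
proof -
  assume e: "e \<ge> 1"
  \<comment> \<open>At a = -1 the first two factors are both 1 + 2^e.\<close>
  have "wpf (- 1) (2 :: complex) e \<noteq> 0" unfolding wpf_def
    using two_power_ne[OF e] by (simp add: add_eq_0_iff)
  thus ?thesis using has_val_ne[OF has_val_wpf[of "- 1" 2 e] has_val_0] by simp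
qed

text \<open>
  The points where the denominator of \<open>wp\<close> does not vanish once \<open>(q;q\<^sup>2)\<^sub>k / (q\<^sup>2;q\<^sup>2)\<^sub>k\<close> is written as a
  \<open>q\<close>-binomial coefficient over the square of \<open>(-q;q)\<^sub>k\<close>; roots of unity of odd order are not excluded.
\<close>

definition regular_point :: "complex \<Rightarrow> complex \<Rightarrow> bool" where
  "regular_point z w \<longleftrightarrow> w \<noteq> 0 \<and> (\<forall>i\<ge>1. z ^ i \<noteq> - 1) \<and>
     (\<forall>i. w * z ^ (2 * i + 2) \<noteq> 1 \<and> z ^ (2 * i + 2) \<noteq> w)"

lemma has_val_wp:
  assumes "regular_point z w"
  shows "\<exists>v. has_val z w (wp aR qR k) v"
proof -
  have w: "w \<noteq> 0" and z: "\<And>i. 1 + z ^ (i + 1) \<noteq> 0"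
    and wz: "\<And>i. 1 - w * z ^ (2 * i + 2) \<noteq> 0" "\<And>i. 1 - z ^ (2 * i + 2) / w \<noteq> 0"
    using assms unfolding regular_point_def by (auto simp: add_eq_0_iff simp del: power_Suc)
  \<comment> \<open>\<open>B\<close> is the q-binomial coefficient of 2k over k.\<close>
  obtain B where B: "(\<Prod>i<k. 1 - qP ^ (k + i + 1)) = (\<Prod>i<k. 1 - qP ^ (i + 1)) * B"
    using q_factorial_dvd[where q = qP and k = k and m = k] unfolding dvd_def by blast
  have BR: "(\<Prod>i<k. 1 - qR ^ (k + i + 1)) = (\<Prod>i<k. 1 - qR ^ (i + 1)) * of_pol B"
    using arg_cong[OF B, of of_pol] unfolding of_pol_hom of_pol_prod of_pol_power qR_def .
  define N where "N = (\<Prod>i<k. 1 + qR ^ (i + 1))"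
  define D where "D = (\<Prod>i<k. 1 - qR ^ (i + 1))"
  have nz: "N \<noteq> 0" "D \<noteq> 0"
    using qR_power_ne[of "Suc _"] unfolding N_def D_def by (simp_all add: add_eq_0_iff del: power_Suc)
  have 1: "(\<Prod>i<k. 1 - qR ^ (2 * i + 1)) = D * of_pol B / N"
    using q_factorial_split[of qR k] qR_power_ne(1) BR nz
    unfolding N_def[symmetric] D_def[symmetric] by (simp add: eq_divide_eq)
  have 2: "(\<Prod>i<k. 1 - qR ^ (2 * i + 2)) = D * N"
    unfolding D_def N_def prod.distrib[symmetric]
    by (rule prod.cong) (simp_all add: algebra_simps flip: power_add mult_2)
  have "wp aR qR k = (- 1) ^ k * qR ^ (k\<^sup>2) *
    ((\<Prod>i<k. (1 - aR * qR ^ (2 * i + 1)) * (1 - qR ^ (2 * i + 1) / aR)) /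
     (\<Prod>i<k. (1 - aR * qR ^ (2 * i + 2)) * (1 - qR ^ (2 * i + 2) / aR))) *
    (of_pol B / (N * N))"
  proof -
    have 3: "(\<Prod>i<k. wpf aR qR (2 * i + e)) =
      (\<Prod>i<k. (1 - aR * qR ^ (2 * i + e)) * (1 - qR ^ (2 * i + e) / aR)) * (\<Prod>i<k. 1 - qR ^ (2 * i + e))" for e
      unfolding wpf_def by (rule prod.distrib)
    thus ?thesis unfolding wp_def qpoch_wpf 3 1 2 using nz by simp (simp add: mult_ac)
  qed
  moreover have "has_val z w \<dots> ((- 1) ^ k * z ^ (k\<^sup>2) *
    ((\<Prod>i<k. (1 - w * z ^ (2 * i + 1)) * (1 - z ^ (2 * i + 1) / w)) /
     (\<Prod>i<k. (1 - w * z ^ (2 * i + 2)) * (1 - z ^ (2 * i + 2) / w))) *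
    (ev z w B / ((\<Prod>i<k. 1 + z ^ (i + 1)) * (\<Prod>i<k. 1 + z ^ (i + 1)))))"
    unfolding N_def
    by (intro has_val_intros has_val_of_pol w) (use z wz in \<open>simp_all add: w del: power_Suc\<close>)
  ultimately show ?thesis by metis
qed

text \<open>The recurrence holds between rational functions, where \<open>wpf\<close> is nonzero,
  and passes to values by uniqueness, also at points where \<open>wpf\<close> vanishes.\<close>

lemma has_val_wp_sequence:
  assumes "regular_point z w"
  obtains s where "\<And>k. has_val z w (wp aR qR k) (s k)" "s 0 = 1"
    "\<And>k. s (Suc k) * wpf w z (2 * k + 2) = - (z ^ (2 * k + 1)) * wpf w z (2 * k + 1) * s k"
proof -
  have w: "w \<noteq> 0" using assms by (simp add: regular_point_def)
  obtain s where s: "\<And>k. has_val z w (wp aR qR k) (s k)"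
    using has_val_wp[OF assms] by metis
  have "s 0 = 1" using has_val_unique[OF s[of 0]] has_val_1 by (simp add: wp_0)
  moreover have "s (Suc k) * wpf w z (2 * k + 2) = - (z ^ (2 * k + 1)) * wpf w z (2 * k + 1) * s k" for k
  proof (rule has_val_unique)
    show "has_val z w (wp aR qR (Suc k) * wpf aR qR (2 * k + 2)) (s (Suc k) * wpf w z (2 * k + 2))"
      by (intro has_val_intros s has_val_wpf w)
    show "has_val z w (wp aR qR (Suc k) * wpf aR qR (2 * k + 2))
        (- (z ^ (2 * k + 1)) * wpf w z (2 * k + 1) * s k)"
      by (subst wp_Suc, rule wpf_R_nonzero, simp) (intro has_val_intros s has_val_wpf w)
  qed
  ultimately show ?thesis using that s by blast
qed

lemma has_val_qint: "has_val z w (qint qR m) (qint z m)"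
  unfolding qint_def by (intro has_val_intros)

section \<open>The double sum\<close>

lemma double_sum_eq:
  fixes c :: "nat \<Rightarrow> 'a::comm_ring_1"
  assumes "n > 0"
  shows "(\<Sum>k = 0..n - 1. \<Sum>j = 0..k. c j * c (k - j)) = (\<Sum>j<n. c j * (\<Sum>i<n - j. c i))"
proof -
  have "(\<Sum>k = 0..n - 1. \<Sum>j = 0..k. c j * c (k - j)) = (\<Sum>k<n. \<Sum>j\<le>k. c j * c (k - j))"
    by (rule sum.cong) (use assms in \<open>auto simp: atLeast0AtMost\<close>)
  also have "\<dots> = (\<Sum>(j, i)\<in>{(j, i). j + i < n}. c j * c i)"
    by (rule sum.triangle_reindex[symmetric])
  also have "{(j, i). j + i < n} = (SIGMA j:{..<n}. {..<n - j})" by auto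
  also have "(\<Sum>(j, i)\<in>(SIGMA j:{..<n}. {..<n - j}). c j * c i) = (\<Sum>j<n. c j * (\<Sum>i<n - j. c i))"
    by (subst sum.Sigma[symmetric]) (simp_all add: sum_distrib_left)
  finally show ?thesis .
qed

text \<open>No pair with i + j <= 2M has both indices above \<open>M\<close>, and the square i, j <=
  M lies inside this triangle; the rest is two mirror images.\<close>

lemma double_sum_split:
  fixes c :: "nat \<Rightarrow> 'a::comm_ring_1"
  assumes n: "n = 2 * M + 1"
  shows "(\<Sum>j<n. c j * (\<Sum>i<n - j. c i)) =
     (\<Sum>j\<le>M. c j)\<^sup>2 + 2 * (\<Sum>j\<in>{M<..<n}. c j * (\<Sum>i<n - j. c i))"
proof -
  let ?A = "(\<Sum>j\<in>{M<..<n}. c j * (\<Sum>i<n - j. c i))"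
  have split: "sum f {..<m} = sum f {..M} + sum f {M<..<m}" if "M < m" for f :: "nat \<Rightarrow> 'a" and m
  proof -
    have "{..<m} = {..M} \<union> {M<..<m}" using that by auto
    moreover have "sum f ({..M} \<union> {M<..<m}) = sum f {..M} + sum f {M<..<m}"
      by (rule sum.union_disjoint) auto
    ultimately show ?thesis by metis
  qed
  have 1: "(\<Sum>j<n. c j * (\<Sum>i<n - j. c i)) = (\<Sum>j\<le>M. c j * (\<Sum>i<n - j. c i)) + ?A"
    by (rule split) (use n in simp)
  have 2: "c j * (\<Sum>i<n - j. c i) = c j * (\<Sum>i\<le>M. c i) + (\<Sum>i\<in>{M<..<n - j}. c j * c i)"
    if "j \<le> M" for j
  proof -
    have "(\<Sum>i<n - j. c i) = (\<Sum>i\<le>M. c i) + (\<Sum>i\<in>{M<..<n - j}. c i)"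
      by (rule split) (use that n in simp)
    thus ?thesis by (simp only: distrib_left sum_distrib_left)
  qed
  have "(\<Sum>j\<le>M. c j * (\<Sum>i<n - j. c i)) =
      (\<Sum>j\<le>M. c j * (\<Sum>i\<le>M. c i) + (\<Sum>i\<in>{M<..<n - j}. c j * c i))"
    by (rule sum.cong) (use 2 in auto)
  hence 3: "(\<Sum>j\<le>M. c j * (\<Sum>i<n - j. c i)) =
      (\<Sum>j\<le>M. c j)\<^sup>2 + (\<Sum>j\<le>M. \<Sum>i\<in>{M<..<n - j}. c j * c i)"
    by (simp only: sum.distrib power2_eq_square sum_distrib_right)
  have "(\<Sum>j\<le>M. \<Sum>i\<in>{M<..<n - j}. c j * c i) =
      (\<Sum>j\<in>{..M}. \<Sum>i | i \<in> {M<..<n} \<and> i + j < n. c j * c i)"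
    by (intro sum.cong) auto
  also have "\<dots> = (\<Sum>i\<in>{M<..<n}. \<Sum>j | j \<in> {..M} \<and> i + j < n. c j * c i)"
    by (rule sum.swap_restrict) simp_all
  also have "\<dots> = ?A"
  proof (rule sum.cong)
    fix i assume "i \<in> {M<..<n}"
    hence "{j \<in> {..M}. i + j < n} = {..<n - i}" using n by auto
    thus "(\<Sum>j | j \<in> {..M} \<and> i + j < n. c j * c i) = c i * (\<Sum>j<n - i. c j)"
      by (simp only: sum_distrib_left mult.commute)
  qed simp
  finally show ?thesis unfolding 1 3 by (simp only: mult_2 add.assoc)
qed

section \<open>Values at primitive roots of unity\<close>

lemma infinite_norm_gt_1: "infinite {w :: complex. cmod w > 1}"
proof
  assume "finite {w :: complex. cmod w > 1}"
  moreover have "(of_nat :: nat \<Rightarrow> complex) ` {2..} \<subseteq> {w. cmod w > 1}" by auto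
  ultimately have "finite ((of_nat :: nat \<Rightarrow> complex) ` {2..})" by (rule finite_subset[rotated])
  hence "finite {2 :: nat..}" by (rule finite_imageD) (simp add: inj_on_def)
  thus False by (simp add: infinite_Ici)
qed

lemma norm_gt_1_power:
  fixes z :: complex
  assumes "cmod z > 1" "i \<ge> 1"
  shows "z ^ i \<noteq> 1" "z ^ i \<noteq> - 1"
proof -
  have "cmod (z ^ i) > 1" using assms by (simp add: norm_power one_less_power)
  thus "z ^ i \<noteq> 1" "z ^ i \<noteq> - 1" by auto
qed

text \<open>Powers of \<open>z\<close> have modulus 1, so \<open>w\<close> avoids them and their
  inverses; as the order is odd, -1 is not among them.\<close>

lemma primitive_root:
  assumes d: "d = 2 * M + 1" "M \<ge> 1" and z: "primitive_root_unity d z" and w: "cmod w > 1"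
  shows "wpf_root_of_unity w z d M" "regular_point z w"
proof -
  have zd: "z ^ d = 1" and least: "\<And>m. 0 < m \<Longrightarrow> m < d \<Longrightarrow> z ^ m \<noteq> 1"
    using z by (auto simp: primitive_root_unity_def)
  have "cmod z ^ d = 1" using zd by (metis norm_one norm_power)
  hence nz: "cmod z = 1" using d power_eq_iff_eq_base[of d "cmod z" 1] by simp
  have w0: "w \<noteq> 0" using w by auto
  have nw: "1 - w * z ^ e \<noteq> 0" "z ^ e \<noteq> w" for e
  proof -
    have "cmod (w * z ^ e) > 1" "cmod (z ^ e) < cmod w" using w nz by (simp_all add: norm_mult norm_power)
    thus "1 - w * z ^ e \<noteq> 0" "z ^ e \<noteq> w" by auto
  qed
  have dvd: "z ^ e \<noteq> 1" if "\<not> d dvd e" for e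
  proof -
    have "z ^ e = z ^ (d * (e div d)) * z ^ (e mod d)" by (simp only: power_add[symmetric] mult_div_mod_eq)
    moreover have "z ^ (e mod d) \<noteq> 1" using that d by (intro least) (auto simp: mod_greater_zero_iff_not_dvd)
    ultimately show ?thesis by (simp add: power_mult zd)
  qed
  show "wpf_root_of_unity w z d M"
  proof
    show "wpf w z e \<noteq> 0" if "\<not> d dvd e" for e
      unfolding wpf_def using dvd[OF that] nw[of e] w0 by simp
    show "z \<noteq> 1" using least[of 1] d by simp
  qed (use d zd w0 in auto)
  have "z ^ i \<noteq> - 1" for i
  proof
    assume i: "z ^ i = - 1"
    have "(z ^ i) ^ d = (z ^ d) ^ i" by (simp only: power_mult[symmetric] mult.commute)
    thus False using d unfolding i zd by simp
  qed
  moreover have "w * z ^ e \<noteq> 1" for e using nw(1)[of e] by auto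
  ultimately show "regular_point z w" unfolding regular_point_def using w0 nw(2) by blast
qed

lemma has_val_cq:
  "has_val z w (wp aR qR k) v \<Longrightarrow> has_val z w (cq k) (qint z (4 * k + 1) * v)"
  unfolding cq_eq by (intro has_val_mult has_val_qint)

lemma primitive_root_sequence:
  assumes d: "d = 2 * M + 1" "M \<ge> 1" and z: "primitive_root_unity d z" and w: "cmod w > 1"
  obtains s where "wpf_sequence w z d M s" "\<And>k. has_val z w (wp aR qR k) (s k)"
    "\<And>k. has_val z w (cq k) (wpf_sequence.c z s k)"
    "\<And>m. has_val z w (\<Sum>i<m. cq i) (wpf_sequence.T z s m)"
proof -
  obtain s where s: "\<And>k. has_val z w (wp aR qR k) (s k)" "s 0 = 1"
    "\<And>k. s (Suc k) * wpf w z (2 * k + 2) = - (z ^ (2 * k + 1)) * wpf w z (2 * k + 1) * s k"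
    by (rule has_val_wp_sequence[OF primitive_root(2)[OF assms]]) blast
  interpret wpf_root_of_unity w z d M by (rule primitive_root(1)[OF assms])
  interpret wpf_sequence w z d M s by unfold_locales (use s in auto)
  have c: "has_val z w (cq k) (c k)" for k
    unfolding c_def by (intro has_val_cq s)
  show ?thesis
    by (rule that[OF wpf_sequence_axioms s(1) c]) (unfold T_def, intro has_val_sum c)
qed

lemma has_val_double_sum_eq_0:
  assumes d: "d = 2 * M + 1" "M \<ge> 1" and z: "primitive_root_unity d z" and w: "cmod w > 1"
  shows "has_val z w (\<Sum>j<m * d. cq j * (\<Sum>i<m * d - j. cq i)) 0"
proof -
  obtain s where s: "wpf_sequence w z d M s"
    "\<And>k. has_val z w (cq k) (wpf_sequence.c z s k)"
    "\<And>m. has_val z w (\<Sum>i<m. cq i) (wpf_sequence.T z s m)"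
    by (rule primitive_root_sequence[OF assms]) blast
  interpret wpf_sequence w z d M s by (rule s)
  have "has_val z w (\<Sum>j<m * d. cq j * (\<Sum>i<m * d - j. cq i)) (\<Sum>j<m * d. c j * T (m * d - j))"
    by (intro has_val_sum has_val_mult s)
  thus ?thesis unfolding convolution_eq_0 .
qed

lemma rat_cong_cyclotomicI:
  assumes n: "n > 0"
    and val: "\<And>z w. primitive_root_unity n z \<Longrightarrow> cmod w > 1 \<Longrightarrow> has_val z w x 0"
  shows "rat_cong x 0 [:cyclotomic n:]"
proof (rule rat_cong_const_poly[OF map_poly_cyclotomic[OF n] finite_primitive_root_unity[OF n]])
  fix z assume "z \<in> {z. primitive_root_unity n z}"
  hence "{w. cmod w > 1} \<subseteq> {w. has_val z w (x - 0) 0}" using val by auto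
  thus "infinite {w. has_val z w (x - 0) 0}" using infinite_norm_gt_1 finite_subset by blast
qed

section \<open>Factorization of [n]\<close>

definition X1 :: "int poly" where "X1 = [:0, 1:]"

lemma ipoly_X1 [simp]: "ipoly X1 z = z"
  by (simp add: X1_def)

lemma map_poly_qint_mult:
  "[:- 1, 1:] * map_poly of_int (qint X1 n) = (monom 1 n - 1 :: complex poly)"
proof -
  have "(X1 - 1) * qint X1 n = X1 ^ n - 1"
    using qint_mult[of X1 n] by (simp add: algebra_simps)
  also have "X1 ^ n = monom 1 n" by (simp add: X1_def monom_altdef)
  finally have "map_poly of_int ((X1 - 1) * qint X1 n) = (map_poly of_int (monom 1 n - 1) :: complex poly)"
    by simp
  moreover have "map_poly of_int (X1 - 1) = [:- 1, 1 :: complex:]"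
    by (simp add: X1_def of_int_poly_diff map_poly_pCons one_pCons)
  ultimately show ?thesis by (simp only: of_int_poly_mult) (simp add: of_int_poly_diff map_poly_monom)
qed

text \<open>For n > 1 these are the roots of [n] / Phi_n.\<close>

definition nonprimitive_roots :: "nat \<Rightarrow> complex set" where
  "nonprimitive_roots n = {z. z ^ n = 1 \<and> z \<noteq> 1 \<and> \<not> primitive_root_unity n z}"

lemma finite_nonprimitive_roots: "n > 0 \<Longrightarrow> finite (nonprimitive_roots n)"
  by (rule finite_subset[OF _ finite_roots_unity[where 'a = complex and n = n]])
    (auto simp: nonprimitive_roots_def)

lemma map_poly_qint:
  assumes n: "n > 1"
  shows "(map_poly of_int (qint X1 n) :: complex poly) =
    map_poly of_int (cyclotomic n) * (\<Prod>z\<in>nonprimitive_roots n. [:- z, 1:])"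
proof -
  let ?P = "{z. primitive_root_unity n z}"
  have n0: "n > 0" using n by simp
  have 1: "\<not> primitive_root_unity n 1"
    using n by (auto simp: primitive_root_unity_def)
  have eq: "{z :: complex. z ^ n = 1} = insert 1 (?P \<union> nonprimitive_roots n)"
    by (auto simp: nonprimitive_roots_def primitive_root_unity_def)
  have "[:- 1, 1:] * map_poly of_int (qint X1 n) = (\<Prod>z | z ^ n = (1::complex). [:- z, 1:])"
    unfolding map_poly_qint_mult roots_unity_factorization[OF n0] ..
  also have "\<dots> = [:- 1, 1:] * (\<Prod>z\<in>?P \<union> nonprimitive_roots n. [:- z, 1:])"
    unfolding eq using 1 finite_primitive_root_unity[OF n0] finite_nonprimitive_roots[OF n0]
    by (subst prod.insert) (auto simp: nonprimitive_roots_def)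
  also have "(\<Prod>z\<in>?P \<union> nonprimitive_roots n. [:- z, 1:]) =
      (\<Prod>z\<in>?P. [:- z, 1:]) * (\<Prod>z\<in>nonprimitive_roots n. [:- z, 1:])"
    by (rule prod.union_disjoint)
      (use finite_primitive_root_unity[OF n0] finite_nonprimitive_roots[OF n0] in
        \<open>auto simp: nonprimitive_roots_def\<close>)
  also have "[:- 1, 1:] \<noteq> (0 :: complex poly)" by simp
  note mult_left_cancel[OF this]
  finally show ?thesis unfolding map_poly_cyclotomic[OF n0] .
qed

lemma lead_coeff_1_if_map_poly:
  assumes "map_poly of_int f = (\<Prod>z\<in>Z. [:- z, 1 :: complex:])"
  shows "lead_coeff f = 1"
proof -
  have "lead_coeff (map_poly of_int f :: complex poly) = 1"
    unfolding assms lead_coeff_prod by simp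
  thus ?thesis by (simp add: degree_of_int_poly coeff_map_poly)
qed

lemma qint_factorization:
  assumes n: "n > 1"
  obtains R where "qint X1 n = cyclotomic n * R"
    "map_poly of_int R = (\<Prod>z\<in>nonprimitive_roots n. [:- z, 1:])"
proof -
  have n0: "n > 0" using n by simp
  have "cyclotomic n dvd qint X1 n"
    by (rule monic_int_poly_dvdI[OF lead_coeff_1_if_map_poly[OF map_poly_cyclotomic[OF n0]]])
      (simp add: map_poly_qint[OF n])
  then obtain R where R: "qint X1 n = cyclotomic n * R" by (elim dvdE)
  have c0: "map_poly of_int (cyclotomic n) \<noteq> (0 :: complex poly)"
    using lead_coeff_1_if_map_poly[OF map_poly_cyclotomic[OF n0]] map_poly_of_int_eq_iff[of "cyclotomic n" 0]
    by auto
  have "map_poly of_int (cyclotomic n) * map_poly of_int R =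
      map_poly of_int (cyclotomic n) * (\<Prod>z\<in>nonprimitive_roots n. [:- z, 1 :: complex:])"
    unfolding map_poly_qint[OF n, symmetric] R of_int_poly_mult ..
  hence "map_poly of_int R = (\<Prod>z\<in>nonprimitive_roots n. [:- z, 1 :: complex:])"
    by (simp only: mult_left_cancel[OF c0])
  with R show ?thesis by (rule that)
qed

lemma nonprimitive_rootE:
  assumes "odd n" "z \<in> nonprimitive_roots n"
  obtains d M m where "d = 2 * M + 1" "M \<ge> 1" "n = m * d" "primitive_root_unity d z"
proof -
  have n: "n > 0" using assms(1) by (simp add: odd_pos)
  have z: "z ^ n = 1" "z \<noteq> 1" using assms(2) by (auto simp: nonprimitive_roots_def)
  obtain d where d: "d dvd n" "primitive_root_unity d z"
    using z(1) roots_unity_partition[OF n] by blast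
  have "odd d" using d(1) assms(1) by (meson dvd_trans)
  then obtain M where M: "d = 2 * M + 1" by (elim oddE)
  have "M \<ge> 1"
  proof (rule ccontr)
    assume "\<not> M \<ge> 1"
    hence "d = 1" using M by simp
    thus False using d(2) z(2) by (simp add: primitive_root_unity_def)
  qed
  thus ?thesis using that M d by (metis dvd_def mult.commute)
qed

section \<open>The points a = q^n and a = q^(-n)\<close>

lemma has_val_double_sum_terminating:
  assumes z: "cmod z > 1" and n: "n = 2 * M + 1" and w: "w = z ^ n \<or> w = inverse (z ^ n)"
  shows "has_val z w (\<Sum>j<n. cq j * (\<Sum>i<n - j. cq i)) (z ^ (2 * M\<^sup>2) * (qint z n)\<^sup>2)"
proof -
  have z0: "z \<noteq> 0" using z by auto
  have inj: "z ^ i \<noteq> z ^ j" if "i < j" for i j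
  proof -
    have "z ^ j = z ^ i * z ^ (j - i)" using that by (simp flip: power_add)
    thus ?thesis using norm_gt_1_power(1)[OF z, of "j - i"] that z0 by auto
  qed
  have inj': "z ^ i \<noteq> z ^ j" if "i \<noteq> j" for i j
    using inj[of i j] inj[of j i] that by (metis linorder_neqE_nat)
  \<comment> \<open>Since \<open>n\<close> is odd, no denominator of \<open>cq\<close>, having even
    exponents, vanishes at a = z^n or its inverse.\<close>
  have ne: "2 * i + 2 \<noteq> n" for i using n by presburger
  have 1: "z ^ n * z ^ (2 * i + 2) \<noteq> 1" for i
    unfolding power_add[symmetric] by (rule norm_gt_1_power(1)[OF z]) simp
  have reg: "regular_point z w" unfolding regular_point_def
  proof (intro conjI allI impI)
    show "w \<noteq> 0" using w z0 by auto
    show "z ^ i \<noteq> - 1" if "1 \<le> i" for i by (rule norm_gt_1_power(2)[OF z that])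
    have inv: "inverse a * b \<noteq> 1" if "b \<noteq> a" "a \<noteq> 0" for a b :: complex
      using that by (simp add: field_simps)
    have inv': "b \<noteq> inverse a" if "a * b \<noteq> 1" "a \<noteq> 0" for a b :: complex
      using that by auto
    have zn: "z ^ n \<noteq> 0" using z0 by simp
    show "w * z ^ (2 * i + 2) \<noteq> 1" for i
      using w 1[of i] inv[OF inj'[OF ne[of i]] zn] by metis
    show "z ^ (2 * i + 2) \<noteq> w" for i
      using w inv'[OF 1[of i] zn] inj'[OF ne[of i]] by metis
  qed
  have wpf: "wpf w z e = wpf (z ^ n) z e" for e using w wpf_inverse by metis
  obtain s where s: "\<And>k. has_val z w (wp aR qR k) (s k)" "s 0 = 1"
    "\<And>k. s (Suc k) * wpf (z ^ n) z (2 * k + 2) = - (z ^ (2 * k + 1)) * wpf (z ^ n) z (2 * k + 1) * s k"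
    using has_val_wp_sequence[OF reg] unfolding wpf by blast
  define c where "c k = qint z (4 * k + 1) * s k" for k
  have c: "has_val z w (cq k) (c k)" for k
    unfolding c_def by (intro has_val_cq s)
  have sum_s: "(\<Sum>k\<le>M. (1 - z ^ (4 * k + 1)) * s k) = (- 1) ^ M * z ^ (M\<^sup>2) * (1 - z ^ n)"
    unfolding n by (rule wpf_sum(1)[OF z0 _ s(2) s(3)[unfolded n]]) (rule norm_gt_1_power(1)[OF z])
  have s_eq_0: "s k = 0" if "k > M" for k
    by (rule wpf_sum(2)[OF z0 _ s(2) s(3)[unfolded n] that]) (rule norm_gt_1_power(1)[OF z])
  have z1: "1 - z \<noteq> 0" using norm_gt_1_power(1)[OF z, of 1] by simp
  have "(1 - z) * (\<Sum>k\<le>M. c k) = (\<Sum>k\<le>M. (1 - z ^ (4 * k + 1)) * s k)"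
    unfolding sum_distrib_left c_def by (simp only: mult.assoc[symmetric] qint_mult)
  also have "\<dots> = (- 1) ^ M * z ^ (M\<^sup>2) * (1 - z ^ n)"
    by (rule sum_s)
  also have "\<dots> = (1 - z) * ((- 1) ^ M * z ^ (M\<^sup>2) * qint z n)"
    unfolding qint_mult[symmetric] by (simp only: mult_ac)
  finally have sum: "(\<Sum>k\<le>M. c k) = (- 1) ^ M * z ^ (M\<^sup>2) * qint z n"
    by (simp only: mult_left_cancel[OF z1])
  \<comment> \<open>Only the square in \<open>double_sum_split\<close> survives, and squaring
    removes the sign (-1)^M.\<close>
  have "(\<Sum>j\<in>{M<..<n}. c j * (\<Sum>i<n - j. c i)) = 0"
    by (rule sum.neutral) (use s_eq_0 in \<open>auto simp: c_def\<close>)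
  hence "(\<Sum>j<n. c j * (\<Sum>i<n - j. c i)) = ((- 1) ^ M * z ^ (M\<^sup>2) * qint z n)\<^sup>2"
    unfolding double_sum_split[OF n] sum by simp
  also have "\<dots> = z ^ (2 * M\<^sup>2) * (qint z n)\<^sup>2"
    by (simp add: power_mult_distrib mult.commute flip: power_mult)
  finally have eq: "(\<Sum>j<n. c j * (\<Sum>i<n - j. c i)) = z ^ (2 * M\<^sup>2) * (qint z n)\<^sup>2" .
  have "has_val z w (\<Sum>j<n. cq j * (\<Sum>i<n - j. cq i)) (\<Sum>j<n. c j * (\<Sum>i<n - j. c i))"
    by (intro has_val_sum has_val_mult c)
  thus ?thesis unfolding eq .
qed

lemma coprime_const_polyI:
  fixes f g :: "int poly"
  assumes "coprime f g" "f \<noteq> 0"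
  shows "coprime [:f:] [:g:]"
proof (rule coprimeI)
  fix h assume h: "h dvd [:f:]" "h dvd [:g:]"
  have "degree h \<le> degree [:f:]" using h(1) by (rule dvd_imp_degree_le) (use assms in auto)
  then obtain h0 where h0: "h = [:h0:]" by (metis degree_pCons_0 le_zero_eq degree_eq_zeroE)
  hence "is_unit h0" using h assms(1) by (simp add: coprime_common_divisor)
  thus "is_unit h" unfolding h0 by (simp add: is_unit_const_poly_iff)
qed

section \<open>Congruences modulo Phi_n and Phi_n^2\<close>

lemma rat_cong_first_sum:
  assumes n: "n = 2 * M + 1" and M: "M \<ge> 1"
  shows "rat_cong (\<Sum>j\<le>M. cq j) 0 [:cyclotomic n:]"
proof (rule rat_cong_cyclotomicI)
  fix z w assume z: "primitive_root_unity n z" and w: "cmod w > 1"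
  obtain s where s: "wpf_sequence w z n M s"
    "\<And>m. has_val z w (\<Sum>i<m. cq i) (wpf_sequence.T z s m)"
    by (rule primitive_root_sequence[OF n M z w]) blast
  interpret wpf_sequence w z n M s by (rule s)
  have "T (Suc M) = 0" by (rule T_eq_0_first) (use n M in auto)
  thus "has_val z w (\<Sum>j\<le>M. cq j) 0" using s(2)[of "Suc M"] by (simp add: lessThan_Suc_atMost)
qed (use n in simp)

lemma const_poly_X1: "[:X1 ^ n:] = qP ^ n"
proof (induction n)
  case (Suc n)
  have "[:X1 ^ Suc n:] = [:X1:] * [:X1 ^ n:]" by simp
  thus ?case unfolding Suc by (simp only: qP_def X1_def power_Suc)
qed (simp add: one_pCons)

lemma const_poly_qint: "[:qint X1 n:] = qint qP n"
proof -
  have "[:sum f S:] = (\<Sum>x\<in>S. [:f x:])" for f :: "nat \<Rightarrow> int poly" and S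
  proof (induction S rule: infinite_finite_induct)
    case (insert x S)
    have "[:sum f (insert x S):] = [:f x:] + [:sum f S:]" using insert.hyps by simp
    thus ?case unfolding insert.IH using insert.hyps by simp
  qed simp_all
  thus ?thesis unfolding qint_def const_poly_X1[symmetric] .
qed

lemma of_pol_qint: "of_pol (qint qP n) = qint qR n"
  unfolding qint_def of_pol_sum of_pol_power qR_def ..

lemma rat_cong_second_sum:
  assumes n: "n = 2 * M + 1" and M: "M \<ge> 1"
  shows "rat_cong (2 * (\<Sum>j\<in>{M<..<n}. cq j * (\<Sum>i<n - j. cq i))) 0 ([:cyclotomic n:] * [:cyclotomic n:])"
proof -
  let ?F = "[:cyclotomic n:]"
  have n1: "n > 1" using n M by simp
  obtain R where R: "qint X1 n = cyclotomic n * R"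
    by (rule qint_factorization[OF n1]) blast
  have F0: "of_pol ?F \<noteq> 0"
    using lead_coeff_1_if_map_poly[OF map_poly_cyclotomic[of n]] n by (auto simp: of_pol_eq_0_iff)
  have "qint qP n = ?F * [:R:]" unfolding const_poly_qint[symmetric] R by simp
  hence "qint qR n = of_pol ?F * of_pol [:R:]" by (simp only: of_pol_qint[symmetric] of_pol_mult)
  hence qn: "1 - qR ^ n = of_pol ?F * ((1 - qR) * of_pol [:R:])"
    unfolding qint_mult[symmetric] by (simp only: mult_ac)
  \<comment> \<open>One factor Phi_n is removed; it is present in the numerator of \<open>wp\<close>
    for M < k < n.\<close>
  define e where "e k = wp aR qR k / of_pol ?F" for k
  define Z where "Z = 2 * (\<Sum>j\<in>{M<..<n}. qint qR (4 * j + 1) * e j * (\<Sum>i<n - j. cq i))"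
  have eq: "2 * (\<Sum>j\<in>{M<..<n}. cq j * (\<Sum>i<n - j. cq i)) = of_pol ?F * Z"
    unfolding Z_def mult.left_commute[of _ 2] sum_distrib_left[of "of_pol ?F"] e_def cq_eq
    using F0 by simp
  have e_Suc: "e (Suc k) = - (qR ^ (2 * k + 1)) * wpf aR qR (2 * k + 1) * e k / wpf aR qR (2 * k + 2)" for k
  proof -
    have nz: "wpf aR qR (2 * k + 2) \<noteq> 0" by (rule wpf_R_nonzero) simp
    show ?thesis unfolding e_def nonzero_eq_divide_eq[OF nz] times_divide_eq_left times_divide_eq_right
      wp_Suc[OF nz] ..
  qed
  have "rat_cong Z 0 ?F"
  proof (rule rat_cong_cyclotomicI)
    fix z w assume z: "primitive_root_unity n z" and w: "cmod w > 1"
    obtain s where s: "wpf_sequence w z n M s" "\<And>k. has_val z w (wp aR qR k) (s k)"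
      "\<And>m. has_val z w (\<Sum>i<m. cq i) (wpf_sequence.T z s m)"
      by (rule primitive_root_sequence[OF n M z w]) blast
    interpret wpf_sequence w z n M s by (rule s)
    have ex: "\<exists>v. has_val z w (e k) v" if "M < k" "k < n" for k
      using that
    proof (induction k)
      case (Suc k)
      have nz: "wpf w z (2 * k + 2) \<noteq> 0" by (rule wpf_even_nz) (use Suc.prems in simp)
      show ?case
      proof (cases "k = M")
        case True
        \<comment> \<open>The step from \<open>M\<close> to \<open>M + 1\<close> brings in 1 - q^n,
          whose factor Phi_n cancels the one in the denominator of \<open>e\<close>; hence a value
          exists.\<close>
        have "e (Suc k) = - (qR ^ (2 * k + 1)) * ((1 - aR * qR ^ n) * (1 - qR ^ n / aR) * ((1 - qR) * of_pol [:R:]))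
           * wp aR qR k / wpf aR qR (2 * k + 2)"
          unfolding e_Suc unfolding True n[symmetric] wpf_def[of _ _ n] qn e_def using F0 by simp
        moreover have "has_val z w \<dots> (- (z ^ (2 * k + 1)) *
            ((1 - w * z ^ n) * (1 - z ^ n / w) * ((1 - z) * ev z w [:R:])) * s k / wpf w z (2 * k + 2))"
          by (intro has_val_intros has_val_wpf has_val_of_pol s nz a0)
        ultimately show ?thesis by metis
      next
        case False
        then obtain v where "has_val z w (e k) v" using Suc by auto
        hence "has_val z w (e (Suc k)) (- (z ^ (2 * k + 1)) * wpf w z (2 * k + 1) * v / wpf w z (2 * k + 2))"
          unfolding e_Suc by (intro has_val_intros has_val_wpf nz a0)
        thus ?thesis by blast
      qed
    qed simp
    then obtain v where v: "\<And>k. M < k \<Longrightarrow> k < n \<Longrightarrow> has_val z w (e k) (v k)" by metis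
    have "(\<Sum>j\<in>{M<..<n}. qint z (4 * j + 1) * v j * T (n - j)) = 0"
    proof (rule derived_convolution_eq_0)
      fix k assume k: "M < k" "Suc k < n"
      have nz: "wpf w z (2 * k + 2) \<noteq> 0" by (rule wpf_even_nz) (use k in simp)
      have "has_val z w (e (Suc k)) (- (z ^ (2 * k + 1)) * wpf w z (2 * k + 1) * v k / wpf w z (2 * k + 2))"
        unfolding e_Suc by (intro has_val_intros has_val_wpf nz a0 v) (use k in auto)
      moreover have "has_val z w (e (Suc k)) (v (Suc k))" by (rule v) (use k in auto)
      ultimately have "v (Suc k) = - (z ^ (2 * k + 1)) * wpf w z (2 * k + 1) * v k / wpf w z (2 * k + 2)"
        using has_val_unique by blast
      thus "v (Suc k) * wpf w z (2 * k + 2) = - (z ^ (2 * k + 1)) * wpf w z (2 * k + 1) * v k"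
        using nonzero_eq_divide_eq[OF nz] by blast
    qed
    moreover have "has_val z w (\<Sum>j\<in>{M<..<n}. qint qR (4 * j + 1) * e j * (\<Sum>i<n - j. cq i))
        (\<Sum>j\<in>{M<..<n}. qint z (4 * j + 1) * v j * T (n - j))"
      by (intro has_val_sum has_val_mult has_val_qint v s) auto
    ultimately show "has_val z w Z 0" unfolding Z_def mult_2 using has_val_add by fastforce
  qed (use n in simp)
  \<comment> \<open>One Phi_n is explicit in \<open>eq\<close>, the other comes from
    \<open>Z\<close>.\<close>
  thus ?thesis unfolding eq by (intro rat_cong_0_mult rat_cong_0_of_pol) simp_all
qed

section \<open>Combination of the coprime moduli\<close>

theorem theorem3p4:
  fixes n :: nat
  assumes "odd n"
  shows "rat_cong
    (\<Sum>k = 0..n - 1. \<Sum>j = 0..k. cq j * cq (k - j))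
    (qR ^ ((n - 1)\<^sup>2 div 2) * (qint qR n)\<^sup>2)
    (qint qP n * [:cyclotomic n:] * (1 - aP * qP ^ n) * (aP - qP ^ n))"
proof -
  obtain M where n: "n = 2 * M + 1" using assms by (elim oddE)
  have n0: "n > 0" using n by simp
  define S where "S = (\<Sum>j<n. cq j * (\<Sum>i<n - j. cq i))"
  define Q where "Q = qR ^ (2 * M\<^sup>2) * (qint qR n)\<^sup>2"
  have S: "(\<Sum>k = 0..n - 1. \<Sum>j = 0..k. cq j * cq (k - j)) = S"
    unfolding S_def by (rule double_sum_eq[OF n0])
  have "(n - 1)\<^sup>2 div 2 = 2 * M\<^sup>2" unfolding n by (simp add: power2_eq_square)
  hence Q: "qR ^ ((n - 1)\<^sup>2 div 2) * (qint qR n)\<^sup>2 = Q" unfolding Q_def by simp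
  show ?thesis
  proof (cases "M = 0")
    case True
    \<comment> \<open>For n = 1 both sides equal 1.\<close>
    have "S = Q" unfolding S_def Q_def n True by (simp add: cq_def qint_def qpoch_def)
    thus ?thesis unfolding S Q by (simp add: rat_cong_refl)
  next
    case False
    hence M: "M \<ge> 1" and n1: "n > 1" using n by auto
    let ?F = "[:cyclotomic n:]"
    obtain R where R: "qint X1 n = cyclotomic n * R"
      and R': "map_poly of_int R = (\<Prod>z\<in>nonprimitive_roots n. [:- z, 1:])"
      by (rule qint_factorization[OF n1])
    have qP: "qint qP n = ?F * [:R:]" unfolding const_poly_qint[symmetric] R by simp
    have val_Q: "has_val z w Q (z ^ (2 * M\<^sup>2) * (qint z n)\<^sup>2)" for z w
      unfolding Q_def by (intro has_val_intros has_val_qint)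
    have lc: "lead_coeff (cyclotomic n) = 1" "lead_coeff R = 1"
      using lead_coeff_1_if_map_poly map_poly_cyclotomic[OF n0] R' by blast+
    have root: "primitive_root_unity n z" if "ipoly (cyclotomic n) z = 0" for z
      using that unfolding ipoly_def map_poly_cyclotomic[OF n0] poly_prod
      using finite_primitive_root_unity[OF n0] by auto
    have root': "z \<in> nonprimitive_roots n" if "ipoly R z = 0" for z
      using that unfolding ipoly_def R' poly_prod using finite_nonprimitive_roots[OF n0] by auto
    have "coprime (cyclotomic n) R"
      by (rule coprime_int_polyI[OF lc(1)]) (use root root' in \<open>auto simp: nonprimitive_roots_def\<close>)
    hence cop_FR: "coprime ?F [:R:]" by (rule coprime_const_polyI) (use lc in auto)
    have "rat_cong S Q [:R:]"
    proof (rule rat_cong_const_poly[OF R' finite_nonprimitive_roots[OF n0]])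
      fix z assume z: "z \<in> nonprimitive_roots n"
      then obtain d N m where d: "d = 2 * N + 1" "N \<ge> 1" "n = m * d" "primitive_root_unity d z"
        using nonprimitive_rootE[OF assms] by metis
      \<comment> \<open>\<open>Q\<close> vanishes here through [n], and the double sum by
        \<open>has_val_double_sum_eq_0\<close>.\<close>
      have "(1 - z) * qint z n = 0" using z unfolding qint_mult by (simp add: nonprimitive_roots_def)
      hence "qint z n = 0" using z by (simp add: nonprimitive_roots_def)
      hence "has_val z w (S - Q) 0" if "cmod w > 1" for w
        using has_val_diff[OF has_val_double_sum_eq_0[OF d(1,2,4) that, of m, folded d(3)] val_Q]
        unfolding S_def by simp
      hence "{w. cmod w > 1} \<subseteq> {w. has_val z w (S - Q) 0}" by auto
      thus "infinite {w. has_val z w (S - Q) 0}" using infinite_norm_gt_1 finite_subset by blast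
    qed
    moreover have "rat_cong S Q (?F * ?F)"
    proof (rule rat_cong_0_diff)
      show "rat_cong S 0 (?F * ?F)" unfolding S_def double_sum_split[OF n] power2_eq_square
        by (intro rat_cong_0_add rat_cong_0_mult rat_cong_first_sum[OF n M] rat_cong_second_sum[OF n M])
      have "qP ^ (2 * M\<^sup>2) * (qint qP n)\<^sup>2 = ?F * ?F * (qP ^ (2 * M\<^sup>2) * ([:R:] * [:R:]))"
        unfolding qP power2_eq_square by (simp only: mult_ac)
      hence "?F * ?F dvd qP ^ (2 * M\<^sup>2) * (qint qP n)\<^sup>2" by (rule dvdI)
      moreover have "Q = of_pol (qP ^ (2 * M\<^sup>2) * (qint qP n)\<^sup>2)"
        unfolding Q_def by (simp add: of_pol_mult of_pol_power of_pol_qint qR_def)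
      ultimately show "rat_cong Q 0 (?F * ?F)" using rat_cong_0_of_pol by simp
    qed
    \<comment> \<open>The modulus [n] Phi_n is handled as R Phi_n^2, whose two parts are
      coprime.\<close>
    ultimately have 1: "rat_cong S Q ([:R:] * (?F * ?F))"
      by (rule rat_cong_mult_moduli) (metis cop_FR coprime_commute coprime_mult_right_iff)
    have L1: "1 - aP * qP ^ n = [:1, - (X1 ^ n):]" and L2: "aP - qP ^ n = [:- (X1 ^ n), 1:]"
      unfolding aP_def const_poly_X1[symmetric] by (simp_all add: one_pCons)
    have X0: "X1 ^ n \<noteq> 0" by (simp add: X1_def)
    have inf: "infinite {z. \<exists>w. P z w}"
      if "\<And>z. cmod z > 1 \<Longrightarrow> \<exists>w. P z w" for P :: "complex \<Rightarrow> complex \<Rightarrow> bool"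
    proof -
      have "{z. cmod z > 1} \<subseteq> {z. \<exists>w. P z w}" using that by auto
      thus ?thesis using infinite_norm_gt_1 finite_subset by blast
    qed
    have val: "has_val z w (S - Q) 0" if "cmod z > 1" "w = z ^ n \<or> w = inverse (z ^ n)" for z w
      using has_val_diff[OF has_val_double_sum_terminating[OF that(1) n that(2)] val_Q]
      unfolding S_def by simp
    have 2: "rat_cong S Q [:1, - (X1 ^ n):]"
    proof (rule rat_cong_linear)
      show "infinite {z. \<exists>w. ev z w [:1, - (X1 ^ n):] = 0 \<and> has_val z w (S - Q) 0}"
      proof (rule inf)
        fix z assume z: "cmod z > 1"
        hence "z \<noteq> 0" by auto
        hence "ev z (inverse (z ^ n)) [:1, - (X1 ^ n):] = 0"
          by (simp add: ev_pCons ipoly_minus ipoly_power)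
        thus "\<exists>w. ev z w [:1, - (X1 ^ n):] = 0 \<and> has_val z w (S - Q) 0" using val z by blast
      qed
    qed (use X0 in auto)
    have 3: "rat_cong S Q [:- (X1 ^ n), 1:]"
    proof (rule rat_cong_linear)
      show "infinite {z. \<exists>w. ev z w [:- (X1 ^ n), 1:] = 0 \<and> has_val z w (S - Q) 0}"
      proof (rule inf)
        fix z assume z: "cmod z > 1"
        have "ev z (z ^ n) [:- (X1 ^ n), 1:] = 0"
          by (simp add: ev_pCons ipoly_minus ipoly_power)
        thus "\<exists>w. ev z w [:- (X1 ^ n), 1:] = 0 \<and> has_val z w (S - Q) 0" using val z by blast
      qed
    qed (use X0 in auto)
    have R0: "R * (cyclotomic n * cyclotomic n) \<noteq> 0" using lc by auto
    \<comment> \<open>The second polynomial is itself a nonzero constant in \<open>a\<close>, so it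
      serves as the combination.\<close>
    have cop1: "coprime [:1, - (X1 ^ n):] ([:R:] * (?F * ?F))"
      by (rule coprime_pol2I[where i = 0 and s = 0 and t = 1, OF _ R0]) simp_all
    have cop2: "coprime [:- (X1 ^ n), 1:] ([:R:] * (?F * ?F))"
      by (rule coprime_pol2I[where i = 1 and s = 0 and t = 1, OF _ R0]) simp_all
    have "X1 ^ n * X1 ^ n \<noteq> 1"
    proof
      assume "X1 ^ n * X1 ^ n = 1"
      hence "ipoly (X1 ^ n * X1 ^ n) 0 = 1" by simp
      thus False using n0 by (simp add: ipoly_mult ipoly_power power_0_left)
    qed
    hence "1 - X1 ^ n * X1 ^ n \<noteq> 0" by simp
    \<comment> \<open>The combination is (1 - a q^n) + q^n (a - q^n) = 1 - q^(2n).\<close>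
    hence cop3: "coprime [:1, - (X1 ^ n):] [:- (X1 ^ n), 1:]"
      by (rule coprime_pol2I[where i = 0 and s = 1 and t = "[:X1 ^ n:]", rotated]) simp_all
    have "coprime ([:R:] * (?F * ?F) * [:1, - (X1 ^ n):]) [:- (X1 ^ n), 1:]"
      unfolding coprime_mult_left_iff[of "_ * (_ * _)"]
      by (intro conjI cop3 coprime_commute[THEN iffD1, OF cop2])
    hence "rat_cong S Q ([:R:] * (?F * ?F) * [:1, - (X1 ^ n):] * [:- (X1 ^ n), 1:])"
      by (intro rat_cong_mult_moduli 1 2 3 coprime_commute[THEN iffD1, OF cop1])
    moreover have "[:R:] * (?F * ?F) = qint qP n * ?F" unfolding qP by (simp only: mult_ac)
    ultimately show ?thesis unfolding S Q L1 L2 by metis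
  qed
qed

end
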